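(* Let $\Omega\subset\mathbb{R}^n$ be a bounded extension domain for $W^{s,p}$ and let $V\in L^q(\Omega)$ with $q\in(1,\infty)\cap(\tfrac{n}{sp},\infty)$. Then there exists $u\in\widetilde W^{s,p}(\Omega)$ such that $\|u\|_p=1$ and $$\lambda(V)=\frac12[u]_{s,p}^p+\int_\Omega V(x)|u|^p\,dx.$$ Moreover, $u$ is an eigenfunction associated to $\lambda(V)$.
   Context: Fix $n\ge 1$, $0<s<1<p<\infty$. For an open set $\Omega\subset\mathbb{R}^n$, $W^{s,p}(\Omega)$ is the space of $u\in L^p(\Omega)$ with $[u]_{s,p;\Omega}:=\left(\iint_{\Omega\times\Omega}\frac{|u(x)-u(y)|^p}{|x-y|^{n+sp}}\,dx\,dy\right)^{1/p}<\infty$, normed by $\|u\|_{s,p;\Omega}=(\|u\|_{L^p(\Omega)}^p+[u]_{s,p;\Omega}^p)^{1/p}$. When $\Omega=\mathbb{R}^n$ the set is omitted: $[u]_{s,p}$, $\|u\|_{s,p}$, $\|u\|_p$. An open set $\Omega$ is an extension domain for $W^{s,p}$ if there is $C=C(n,s,p,\Omega)>0$ such that every $u\in W^{s,p}(\Omega)$ has an extension $\tilde u\in W^{s,p}(\mathbb{R}^n)$ with $\tilde u=u$ on $\Omega$ and $\|\tilde u\|_{s,p}\le C\|u\|_{s,p;\Omega}$. $\widetilde W^{s,p}(\Omega)$ is the space of all $u\in W^{s,p}(\Omega)$ whose extension by zero outside $\Omega$ belongs to $W^{s,p}(\mathbb{R}^n)$, normed by the $W^{s,p}(\mathbb{R}^n)$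 norm of the zero extension; such $u$ are always identified with their zero extension to $\mathbb{R}^n$. For $u,v\in W^{s,p}(\mathbb{R}^n)$ put $\mathcal{H}(u,v)=\frac12\iint_{\mathbb{R}^n\times\mathbb{R}^n}\frac{|u(x)-u(y)|^{p-2}(u(x)-u(y))(v(x)-v(y))}{|x-y|^{n+sp}}\,dx\,dy$. A number $\lambda\in\mathbb{R}$ is an eigenvalue (for the potential $V$) if there is a nontrivial $u\in\widetilde W^{s,p}(\Omega)$ (an eigenfunction associated to $\lambda$) with $\mathcal{H}(u,v)+\int_\Omega V|u|^{p-2}uv\,dx=\lambda\int_{\mathbb{R}^n}|u|^{p-2}uv\,dx$ for all $v\in\widetilde W^{s,p}(\Omega)$. $\lambda(V)=\inf\{\frac12[u]_{s,p}^p+\int_\Omega V|u|^p\,dx\colon u\in\widetilde W^{s,p}(\Omega),\ \|u\|_p=1\}$. *)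

theory Defs
  imports "HOL-Analysis.Analysis"
begin

text \<open>
  Elements of the function spaces are represented by functions on the whole of \<open>\<real>\<^sup>n\<close>; for a space
  over \<open>\<Omega>\<close> only the values on \<open>\<Omega>\<close> matter. They are not quotiented by a.e. equality.
\<close>

definition Lp :: "real \<Rightarrow> (real ^ 'n) set \<Rightarrow> (real ^ 'n \<Rightarrow> real) set" where
  "Lp p \<Omega> = {u \<in> borel_measurable (lebesgue_on \<Omega>).
     integrable (lebesgue_on \<Omega>) (\<lambda>x. \<bar>u x\<bar> powr p)}"

definition Lp_norm :: "real \<Rightarrow> (real ^ 'n) set \<Rightarrow> (real ^ 'n \<Rightarrow> real) \<Rightarrow> real" where
  "Lp_norm p \<Omega> u = (LINT x|lebesgue_on \<Omega>. \<bar>u x\<bar> powr p) powr (1 / p)"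

text \<open>
  On the diagonal, which is a null set, the quotients below take the value 0, since \<open>x / 0 = 0\<close>.
\<close>

definition gagliardo_quot :: "real \<Rightarrow> real \<Rightarrow> (real ^ 'n \<Rightarrow> real) \<Rightarrow> (real ^ 'n) \<times> (real ^ 'n) \<Rightarrow> real" where
  "gagliardo_quot s p u = (\<lambda>(x, y). \<bar>u x - u y\<bar> powr p / norm (x - y) powr (real CARD('n) + s * p))"

definition gagliardo :: "real \<Rightarrow> real \<Rightarrow> (real ^ 'n) set \<Rightarrow> (real ^ 'n \<Rightarrow> real) \<Rightarrow> real" where
  "gagliardo s p \<Omega> u =
     (LINT z|(lebesgue_on \<Omega> \<Otimes>\<^sub>M lebesgue_on \<Omega>). gagliardo_quot s p u z) powr (1 / p)"

definition Wsp :: "real \<Rightarrow> real \<Rightarrow> (real ^ 'n) set \<Rightarrow> (real ^ 'n \<Rightarrow> real) set" where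
  "Wsp s p \<Omega> = {u \<in> Lp p \<Omega>.
     integrable (lebesgue_on \<Omega> \<Otimes>\<^sub>M lebesgue_on \<Omega>) (gagliardo_quot s p u)}"

definition Wsp_norm :: "real \<Rightarrow> real \<Rightarrow> (real ^ 'n) set \<Rightarrow> (real ^ 'n \<Rightarrow> real) \<Rightarrow> real" where
  "Wsp_norm s p \<Omega> u = (Lp_norm p \<Omega> u powr p + gagliardo s p \<Omega> u powr p) powr (1 / p)"

definition extension_domain :: "real \<Rightarrow> real \<Rightarrow> (real ^ 'n) set \<Rightarrow> bool" where
  "extension_domain s p \<Omega> \<longleftrightarrow> open \<Omega> \<and>
     (\<exists>C>0. \<forall>u\<in>Wsp s p \<Omega>. \<exists>w\<in>Wsp s p UNIV.
        (\<forall>x\<in>\<Omega>. w x = u x) \<and> Wsp_norm s p UNIV w \<le> C * Wsp_norm s p \<Omega> u)"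

definition zero_ext :: "(real ^ 'n) set \<Rightarrow> (real ^ 'n \<Rightarrow> real) \<Rightarrow> real ^ 'n \<Rightarrow> real" where
  "zero_ext \<Omega> u = (\<lambda>x. if x \<in> \<Omega> then u x else 0)"

text \<open>The elements of \<open>W0sp s p \<Omega>\<close>, i.e. of \<open>W\<close>-tilde, are the zero extensions themselves.\<close>

definition W0sp :: "real \<Rightarrow> real \<Rightarrow> (real ^ 'n) set \<Rightarrow> (real ^ 'n \<Rightarrow> real) set" where
  "W0sp s p \<Omega> = zero_ext \<Omega> ` {u \<in> Wsp s p \<Omega>. zero_ext \<Omega> u \<in> Wsp s p UNIV}"

text \<open>
  For \<open>p < 2\<close> the expression \<open>\<bar>t\<bar> powr (p - 2) * t\<close> is 0 at \<open>t = 0\<close>, as it should be.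
\<close>

definition H_form :: "real \<Rightarrow> real \<Rightarrow> (real ^ 'n \<Rightarrow> real) \<Rightarrow> (real ^ 'n \<Rightarrow> real) \<Rightarrow> real" where
  "H_form s p u v = 1 / 2 *
     (LINT (x, y)|(lebesgue \<Otimes>\<^sub>M lebesgue).
        \<bar>u x - u y\<bar> powr (p - 2) * (u x - u y) * (v x - v y)
          / norm (x - y) powr (real CARD('n) + s * p))"

definition eigenfunction ::
  "real \<Rightarrow> real \<Rightarrow> (real ^ 'n) set \<Rightarrow> (real ^ 'n \<Rightarrow> real) \<Rightarrow> real \<Rightarrow> (real ^ 'n \<Rightarrow> real) \<Rightarrow> bool" where
  "eigenfunction s p \<Omega> V l u \<longleftrightarrow>
     u \<in> W0sp s p \<Omega> \<and> \<not> (AE x in lebesgue. u x = 0) \<and>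
     (\<forall>v\<in>W0sp s p \<Omega>.
        H_form s p u v + (LINT x|lebesgue_on \<Omega>. V x * \<bar>u x\<bar> powr (p - 2) * u x * v x)
          = l * (LINT x|lebesgue. \<bar>u x\<bar> powr (p - 2) * u x * v x))"

definition energy ::
  "real \<Rightarrow> real \<Rightarrow> (real ^ 'n) set \<Rightarrow> (real ^ 'n \<Rightarrow> real) \<Rightarrow> (real ^ 'n \<Rightarrow> real) \<Rightarrow> real" where
  "energy s p \<Omega> V u =
     1 / 2 * gagliardo s p UNIV u powr p + (LINT x|lebesgue_on \<Omega>. V x * \<bar>u x\<bar> powr p)"

definition lambda_V :: "real \<Rightarrow> real \<Rightarrow> (real ^ 'n) set \<Rightarrow> (real ^ 'n \<Rightarrow> real) \<Rightarrow> real" where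
  "lambda_V s p \<Omega> V = Inf {energy s p \<Omega> V u | u. u \<in> W0sp s p \<Omega> \<and> Lp_norm p UNIV u = 1}"

end

theory Submission
  imports Defs "HOL-Complex_Analysis.Great_Picard"
begin

text \<open>
  The proof is the direct method. Write \<open>N\<close> for the dimension, \<open>t = s * p / N\<close>, and \<open>E u\<close> for the
  double integral \<open>[u]\<^sup>p\<close>. Elements of \<open>W0sp s p \<Omega>\<close> are defined on the whole space and vanish
  outside the bounded set \<open>\<Omega>\<close>, so all estimates are carried out on the whole space.

  \<^bold>\<open>Integrability.\<close> If \<open>\<bar>u\<bar> powr (p * m)\<close> is integrable, then by Chebyshev's inequality \<open>\<bar>u\<bar>\<close> is
  below \<open>\<bar>u x\<bar> / 2\<close> on half of a ball about \<open>x\<close> whose radius is controlled by \<open>\<bar>u x\<bar>\<close>. This bounds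
  \<open>\<bar>u x\<bar> powr (p * (1 + t * m))\<close> by a multiple of the inner integral in \<open>E u\<close>
  (\<open>powr_le_gag_density\<close>). Iterating \<open>m \<mapsto> 1 + t * m\<close> from \<open>m = 1\<close> passes every exponent below
  \<open>1 / (1 - t)\<close> if \<open>t < 1\<close>, and every exponent if \<open>t \<ge> 1\<close>; since \<open>q > 1 / t\<close>, it passes the conjugate
  exponent of \<open>q\<close> (\<open>higher_integrability\<close>). Young's inequality then bounds \<open>\<integral> \<bar>V\<bar> * \<bar>u\<bar> powr p\<close>, for
  \<open>u\<close> of unit norm, by a power of \<open>1 + E u\<close> with exponent \<open>1 / (q * t) < 1\<close>, so that the energy is
  bounded below and controls \<open>E u\<close> (\<open>energy_coercive\<close>). It also bounds \<open>V * \<bar>u\<bar> powr p\<close> in some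
  \<open>L\<^sup>a\<close> with \<open>a > 1\<close>.

  \<^bold>\<open>Compactness.\<close> On a ball of radius \<open>\<delta>\<close>, \<open>u\<close> differs from its average by a quantity whose integral
  over \<open>\<Omega>\<close> is small for small \<open>\<delta>\<close>, uniformly for bounded \<open>E u\<close> (\<open>ball_average_difference_le\<close>). A diagonal
  subsequence along which the averages over countably many balls converge is therefore Cauchy in
  \<open>L\<^sup>1\<close>, and a further subsequence converges almost everywhere (\<open>gag_compactness\<close>).

  \<^bold>\<open>Existence.\<close> Along a minimising sequence, \<open>\<integral> V * \<bar>u\<bar> powr p\<close> and \<open>\<integral> \<bar>u\<bar> powr p\<close> converge by
  uniform integrability (\<open>convergent_integrals_of_bounded_powr\<close>), and \<open>E\<close> is lower semicontinuous by
  Fatou's lemma (\<open>gag_energy_liminf\<close>). Admissible functions exist because a cone has finite energy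
  (\<open>cone_in_Wsp\<close>); this is where \<open>s < 1\<close> enters.

  \<^bold>\<open>Euler--Lagrange equation.\<close> By homogeneity the minimiser \<open>u\<close> also minimises
  \<open>energy w - \<lambda> * \<integral> \<bar>w\<bar> powr p\<close> among all \<open>w\<close>, with minimum 0. The difference quotients at \<open>u\<close> in the
  directions \<open>v\<close> and \<open>-v\<close> are nonnegative and converge to the first variation, which is linear in
  \<open>v\<close> and hence vanishes (\<open>first_variation\<close>, \<open>minimiser_is_eigenfunction\<close>).
\<close>

section \<open>The Gagliardo energy as an iterated integral\<close>

lemma sigma_finite_lebesgue: "sigma_finite_measure (lebesgue :: 'a::euclidean_space measure)"
proof -
  obtain A :: "'a set set" where A: "countable A" "A \<subseteq> sets lborel" "\<Union>A = space lborel"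
    "\<forall>a\<in>A. emeasure lborel a \<noteq> \<infinity>"
    using lborel.sigma_finite_countable by blast
  show ?thesis
    by (rule sigma_finite_measure.intro, rule exI[of _ A]) (use A in auto)
qed

interpretation lebesgue: sigma_finite_measure "lebesgue :: 'a::euclidean_space measure"
  by (rule sigma_finite_lebesgue)

lemma borel_measurable_ident_lebesgue [measurable]:
  "(\<lambda>x::'a::euclidean_space. x) \<in> borel_measurable lebesgue"
  by (simp add: measurable_completion)

text \<open>
  The Gagliardo energy is used as an iterated integral with values in \<open>ennreal\<close>, so that it makes
  sense before finiteness is known; the inner integral is a function of one point.
\<close>
definition gag_density :: "real \<Rightarrow> real \<Rightarrow> (real ^ 'n \<Rightarrow> real) \<Rightarrow> real ^ 'n \<Rightarrow> ennreal" where
  "gag_density s p u x = (\<integral>\<^sup>+y. ennreal (gagliardo_quot s p u (x, y)) \<partial>lebesgue)"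

text \<open>The \<open>p\<close>-th power of the Gagliardo seminorm over the whole space, possibly infinite.\<close>
definition gag_energy :: "real \<Rightarrow> real \<Rightarrow> (real ^ 'n \<Rightarrow> real) \<Rightarrow> ennreal" where
  "gag_energy s p u = (\<integral>\<^sup>+x. gag_density s p u x \<partial>lebesgue)"

lemma gagliardo_quot_nonneg [simp]: "0 \<le> gagliardo_quot s p u z"
  by (cases z) (simp add: gagliardo_quot_def)

lemma borel_measurable_gagliardo_quot:
  fixes u :: "real ^ 'n \<Rightarrow> real"
  assumes [measurable]: "u \<in> borel_measurable (lebesgue_on \<Omega>)"
  shows "gagliardo_quot s p u \<in> borel_measurable (lebesgue_on \<Omega> \<Otimes>\<^sub>M lebesgue_on \<Omega>)"
proof -
  have [measurable]: "(\<lambda>x::real^'n. x) \<in> borel_measurable (lebesgue_on \<Omega>)"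
    by (rule measurable_restrict_space1) measurable
  show ?thesis unfolding gagliardo_quot_def by measurable
qed

lemma borel_measurable_gagliardo_quot' [measurable]:
  fixes u :: "real ^ 'n \<Rightarrow> real"
  assumes "u \<in> borel_measurable lebesgue"
  shows "gagliardo_quot s p u \<in> borel_measurable (lebesgue \<Otimes>\<^sub>M lebesgue)"
  using borel_measurable_gagliardo_quot[of u UNIV] assms by (simp add: lebesgue_on_UNIV_eq)

lemma borel_measurable_gag_density [measurable]:
  fixes u :: "real ^ 'n \<Rightarrow> real"
  assumes [measurable]: "u \<in> borel_measurable lebesgue"
  shows "gag_density s p u \<in> borel_measurable lebesgue"
  unfolding gag_density_def by measurable

lemma gag_energy_eq_pair:
  fixes u :: "real ^ 'n \<Rightarrow> real"
  assumes [measurable]: "u \<in> borel_measurable lebesgue"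
  shows "gag_energy s p u = (\<integral>\<^sup>+z. ennreal (gagliardo_quot s p u z) \<partial>(lebesgue \<Otimes>\<^sub>M lebesgue))"
  unfolding gag_energy_def gag_density_def
  by (rule lebesgue.nn_integral_fst) measurable

lemma Wsp_UNIV_iff:
  fixes u :: "real ^ 'n \<Rightarrow> real"
  shows "u \<in> Wsp s p UNIV \<longleftrightarrow> u \<in> borel_measurable lebesgue \<and>
    (\<integral>\<^sup>+x. ennreal (\<bar>u x\<bar> powr p) \<partial>lebesgue) < \<infinity> \<and> gag_energy s p u < \<infinity>"
  by (auto simp: Wsp_def Lp_def lebesgue_on_UNIV_eq gag_energy_eq_pair integrable_iff_bounded)

lemma integrable_gagliardo_quot:
  fixes u :: "real ^ 'n \<Rightarrow> real"
  assumes "u \<in> Wsp s p UNIV"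
  shows "integrable (lebesgue \<Otimes>\<^sub>M lebesgue) (gagliardo_quot s p u)"
  using assms by (simp add: Wsp_def lebesgue_on_UNIV_eq)

lemma integrable_Wsp_powr:
  fixes u :: "real ^ 'n \<Rightarrow> real"
  assumes "u \<in> Wsp s p UNIV"
  shows "integrable lebesgue (\<lambda>x. \<bar>u x\<bar> powr p)"
  using assms by (simp add: Wsp_def Lp_def lebesgue_on_UNIV_eq)

lemma gagliardo_powr_eq:
  fixes u :: "real ^ 'n \<Rightarrow> real"
  assumes "0 < p"
  shows "gagliardo s p UNIV u powr p = (LINT z|(lebesgue \<Otimes>\<^sub>M lebesgue). gagliardo_quot s p u z)"
  using assms by (simp add: gagliardo_def lebesgue_on_UNIV_eq powr_powr)

lemma gagliardo_powr_eq_energy: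
  fixes u :: "real ^ 'n \<Rightarrow> real"
  assumes "0 < p" "u \<in> Wsp s p UNIV"
  shows "ennreal (gagliardo s p UNIV u powr p) = gag_energy s p u"
  using assms integrable_gagliardo_quot[OF assms(2)]
  by (simp add: gagliardo_powr_eq gag_energy_eq_pair Wsp_UNIV_iff nn_integral_eq_integral)

lemma Lp_norm_UNIV_eq_1_iff:
  fixes u :: "real ^ 'n \<Rightarrow> real"
  assumes "0 < p"
  shows "Lp_norm p UNIV u = 1 \<longleftrightarrow> (LINT x|lebesgue. \<bar>u x\<bar> powr p) = 1"
proof
  assume "Lp_norm p UNIV u = 1"
  then have "((LINT x|lebesgue. \<bar>u x\<bar> powr p) powr (1/p)) powr p = 1"
    by (simp add: Lp_norm_def lebesgue_on_UNIV_eq)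
  then show "(LINT x|lebesgue. \<bar>u x\<bar> powr p) = 1"
    using assms by (simp add: powr_powr)
qed (simp add: Lp_norm_def lebesgue_on_UNIV_eq)

lemma Wsp_restrict:
  fixes u :: "real ^ 'n \<Rightarrow> real"
  assumes u: "u \<in> Wsp s p UNIV" and \<Omega>: "\<Omega> \<in> sets lebesgue"
  shows "u \<in> Wsp s p \<Omega>"
proof -
  have [measurable]: "u \<in> borel_measurable lebesgue" and fin: "gag_energy s p u < \<infinity>"
    using u by (auto simp: Wsp_UNIV_iff)
  have m\<Omega>: "u \<in> borel_measurable (lebesgue_on \<Omega>)"
    by (rule measurable_restrict_space1) measurable
  interpret S: sigma_finite_measure "lebesgue_on \<Omega>"
    by (rule sigma_finite_measure_restrict_space[OF sigma_finite_lebesgue \<Omega>])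
  have q: "gagliardo_quot s p u \<in> borel_measurable (lebesgue_on \<Omega> \<Otimes>\<^sub>M lebesgue_on \<Omega>)"
    by (rule borel_measurable_gagliardo_quot[OF m\<Omega>])
  have \<Omega>': "\<Omega> \<inter> space lebesgue \<in> sets lebesgue" using \<Omega> by simp
  have "(\<integral>\<^sup>+z. ennreal (gagliardo_quot s p u z) \<partial>(lebesgue_on \<Omega> \<Otimes>\<^sub>M lebesgue_on \<Omega>))
      = (\<integral>\<^sup>+x. (\<integral>\<^sup>+y. ennreal (gagliardo_quot s p u (x, y)) \<partial>lebesgue_on \<Omega>) \<partial>lebesgue_on \<Omega>)"
    by (rule S.nn_integral_fst[symmetric]) (use q in measurable)
  also have "\<dots> = (\<integral>\<^sup>+x. (\<integral>\<^sup>+y. ennreal (gagliardo_quot s p u (x, y)) * indicator \<Omega> y \<partial>lebesgue)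
      * indicator \<Omega> x \<partial>lebesgue)"
    by (simp add: nn_integral_restrict_space[OF \<Omega>'])
  also have "\<dots> \<le> gag_energy s p u"
    unfolding gag_energy_def gag_density_def
    by (auto intro!: nn_integral_mono simp: indicator_def)
  finally have "integrable (lebesgue_on \<Omega> \<Otimes>\<^sub>M lebesgue_on \<Omega>) (gagliardo_quot s p u)"
    using fin q by (auto simp: integrable_iff_bounded intro: le_less_trans)
  moreover have "integrable (lebesgue_on \<Omega>) (\<lambda>x. \<bar>u x\<bar> powr p)"
    unfolding integrable_restrict_space[OF \<Omega>']
    using integrable_mult_indicator[OF \<Omega> integrable_Wsp_powr[OF u]] by simp
  ultimately show ?thesis
    using m\<Omega> by (simp add: Wsp_def Lp_def)
qed

text \<open>
  Membership in \<open>W0sp s p \<Omega>\<close> involves only the whole space: restriction to \<open>\<Omega>\<close> cannot increase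
  the integrals.
\<close>
lemma W0sp_iff:
  fixes w :: "real ^ 'n \<Rightarrow> real"
  assumes \<Omega>: "\<Omega> \<in> sets lebesgue"
  shows "w \<in> W0sp s p \<Omega> \<longleftrightarrow> w \<in> Wsp s p UNIV \<and> (\<forall>x. x \<notin> \<Omega> \<longrightarrow> w x = 0)"
proof
  assume "w \<in> Wsp s p UNIV \<and> (\<forall>x. x \<notin> \<Omega> \<longrightarrow> w x = 0)"
  moreover from this have "zero_ext \<Omega> w = w" by (auto simp: zero_ext_def fun_eq_iff)
  ultimately show "w \<in> W0sp s p \<Omega>"
    unfolding W0sp_def using Wsp_restrict[OF _ \<Omega>, of w s p]
    by (intro image_eqI[of _ _ w]) auto
qed (auto simp: W0sp_def zero_ext_def)

lemma emeasure_lebesgue_ball: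
  fixes c :: "real ^ 'n"
  assumes "0 \<le> r"
  shows "emeasure lebesgue (ball c r) = ennreal (unit_ball_vol (real CARD('n)) * r powr real CARD('n))"
  using assms emeasure_ball[OF assms, of c]
  by (cases "r = 0") (simp_all add: powr_realpow)

section \<open>Convergence lemmas for powers and integrals\<close>

lemma has_real_derivative_abs_powr:
  fixes x p :: real
  assumes p: "1 < p"
  shows "((\<lambda>x. \<bar>x\<bar> powr p) has_real_derivative p * (\<bar>x\<bar> powr (p - 2) * x)) (at x)"
proof -
  consider "x > 0" | "x < 0" | "x = 0" by linarith
  then show ?thesis
  proof cases
    case 1
    have "((\<lambda>x. x powr p) has_real_derivative p * (\<bar>x\<bar> powr (p - 2) * x)) (at x)"
      using 1 by (auto intro!: derivative_eq_intros simp: powr_diff power2_eq_square divide_simps)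
    then show ?thesis
      by (rule has_field_derivative_transform_within_open[where S = "{0<..}"]) (use 1 in auto)
  next
    case 2
    have "((\<lambda>x. (-x) powr p) has_real_derivative p * (\<bar>x\<bar> powr (p - 2) * x)) (at x)"
      using 2 by (auto intro!: derivative_eq_intros simp: powr_diff power2_eq_square divide_simps)
    then show ?thesis
      by (rule has_field_derivative_transform_within_open[where S = "{..<0}"]) (use 2 in auto)
  next
    case 3
    have "((\<lambda>h::real. \<bar>h\<bar> powr (p - 1)) \<longlongrightarrow> \<bar>0\<bar> powr (p - 1)) (at 0)"
      by (rule tendsto_powr') (use p in \<open>auto intro!: tendsto_intros tendsto_rabs_zero\<close>)
    then have "((\<lambda>h::real. \<bar>h\<bar> powr (p - 1)) \<longlongrightarrow> 0) (at 0)" using p by simp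
    then have "((\<lambda>h::real. \<bar>h\<bar> powr p / h) \<longlongrightarrow> 0) (at 0)"
      by (rule Lim_null_comparison[rotated]) (auto simp: eventually_at powr_diff intro!: exI[of _ 1])
    then show ?thesis
      using 3 by (simp add: DERIV_def)
  qed
qed

lemma abs_add_powr_le:
  fixes a b p :: real
  assumes "0 \<le> p"
  shows "\<bar>a + b\<bar> powr p \<le> 2 powr p * (\<bar>a\<bar> powr p + \<bar>b\<bar> powr p)"
proof -
  have "\<bar>a + b\<bar> powr p \<le> (2 * max \<bar>a\<bar> \<bar>b\<bar>) powr p"
    using assms by (intro powr_mono2) auto
  also have "\<dots> = 2 powr p * max \<bar>a\<bar> \<bar>b\<bar> powr p"
    by (simp add: powr_mult)
  also have "\<dots> \<le> 2 powr p * (\<bar>a\<bar> powr p + \<bar>b\<bar> powr p)"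
    by (intro mult_left_mono) (auto simp: max_def)
  finally show ?thesis .
qed

lemma abs_powr_difference_le:
  fixes a b p t :: real
  assumes p: "1 < p" and t: "0 < t" "t \<le> 1"
  shows "\<bar>\<bar>a + t * b\<bar> powr p - \<bar>a\<bar> powr p\<bar> \<le> t * (p * 2 powr p * (\<bar>a\<bar> powr p + \<bar>b\<bar> powr p))"
proof -
  have der: "((\<lambda>r. \<bar>a + r * b\<bar> powr p) has_real_derivative
      p * (\<bar>a + r * b\<bar> powr (p - 2) * (a + r * b)) * b) (at r)" for r
    by (rule DERIV_chain'[where f = "\<lambda>r. a + r * b" and g = "\<lambda>x. \<bar>x\<bar> powr p",
          OF _ has_real_derivative_abs_powr[OF p], THEN DERIV_cong])
       (auto intro!: derivative_eq_intros)
  obtain z where z: "0 < z" "z < t" and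
    eq: "\<bar>a + t * b\<bar> powr p - \<bar>a + 0 * b\<bar> powr p = (t - 0) * (p * (\<bar>a + z * b\<bar> powr (p - 2) * (a + z * b)) * b)"
    using MVT2[OF t(1), of "\<lambda>r. \<bar>a + r * b\<bar> powr p" "\<lambda>r. p * (\<bar>a + r * b\<bar> powr (p - 2) * (a + r * b)) * b"] der
    by blast
  have pw: "\<bar>c\<bar> powr (p - 2) * \<bar>c\<bar> = \<bar>c\<bar> powr (p - 1)" for c :: real
    by (cases "c = 0") (auto simp: powr_diff power2_eq_square divide_simps)
  have "\<bar>a + z * b\<bar> \<le> \<bar>a\<bar> + \<bar>z * b\<bar>" by linarith
  also have "\<bar>z * b\<bar> \<le> \<bar>b\<bar>" using z t by (auto simp: abs_mult intro: mult_left_le_one_le)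
  finally have le: "\<bar>a + z * b\<bar> \<le> \<bar>a\<bar> + \<bar>b\<bar>" by simp
  have "\<bar>a + z * b\<bar> powr (p - 1) * \<bar>b\<bar> \<le> (\<bar>a\<bar> + \<bar>b\<bar>) powr (p - 1) * (\<bar>a\<bar> + \<bar>b\<bar>)"
    using le p by (intro mult_mono powr_mono2) auto
  also have "\<dots> = (\<bar>a\<bar> + \<bar>b\<bar>) powr p"
    by (cases "\<bar>a\<bar> + \<bar>b\<bar> = 0") (auto simp: powr_diff divide_simps)
  also have "\<dots> \<le> 2 powr p * (\<bar>a\<bar> powr p + \<bar>b\<bar> powr p)"
    using abs_add_powr_le[of p "\<bar>a\<bar>" "\<bar>b\<bar>"] p by simp
  finally have *: "\<bar>a + z * b\<bar> powr (p - 1) * \<bar>b\<bar> \<le> 2 powr p * (\<bar>a\<bar> powr p + \<bar>b\<bar> powr p)" .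
  have "\<bar>\<bar>a + t * b\<bar> powr p - \<bar>a\<bar> powr p\<bar> = t * (p * (\<bar>a + z * b\<bar> powr (p - 1) * \<bar>b\<bar>))"
    using eq t p by (simp add: abs_mult pw)
  also have "\<dots> \<le> t * (p * (2 powr p * (\<bar>a\<bar> powr p + \<bar>b\<bar> powr p)))"
    using t p * by (intro mult_left_mono) auto
  finally show ?thesis by (simp add: mult.assoc)
qed

lemma integrable_weighted_powr_add:
  fixes W A B :: "'a \<Rightarrow> real"
  assumes p: "0 \<le> p"
    and [measurable]: "W \<in> borel_measurable M" "A \<in> borel_measurable M" "B \<in> borel_measurable M"
    and A: "integrable M (\<lambda>x. W x * \<bar>A x\<bar> powr p)"
    and B: "integrable M (\<lambda>x. W x * \<bar>B x\<bar> powr p)"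
  shows "integrable M (\<lambda>x. W x * \<bar>A x + B x\<bar> powr p)"
proof (rule Bochner_Integration.integrable_bound)
  show "integrable M (\<lambda>x. 2 powr p * (\<bar>W x * \<bar>A x\<bar> powr p\<bar> + \<bar>W x * \<bar>B x\<bar> powr p\<bar>))"
    using A B by auto
  show "AE x in M. norm (W x * \<bar>A x + B x\<bar> powr p)
      \<le> norm (2 powr p * (\<bar>W x * \<bar>A x\<bar> powr p\<bar> + \<bar>W x * \<bar>B x\<bar> powr p\<bar>))"
  proof (rule AE_I2)
    fix x
    have "\<bar>W x\<bar> * \<bar>A x + B x\<bar> powr p \<le> \<bar>W x\<bar> * (2 powr p * (\<bar>A x\<bar> powr p + \<bar>B x\<bar> powr p))"
      by (intro mult_left_mono abs_add_powr_le p) auto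
    then show "norm (W x * \<bar>A x + B x\<bar> powr p)
      \<le> norm (2 powr p * (\<bar>W x * \<bar>A x\<bar> powr p\<bar> + \<bar>W x * \<bar>B x\<bar> powr p\<bar>))"
      by (simp add: abs_mult algebra_simps)
  qed
qed measurable

text \<open>
  Derivative at 0 of \<open>r \<mapsto> \<integral> W * \<bar>A + r * B\<bar> powr p\<close> along \<open>r = 1 / (k + 1)\<close>, by dominated convergence.
  The weight may change sign; it will be the singular kernel, the potential, and 1.
\<close>
lemma weighted_powr_difference_quotient:
  fixes W A B :: "'a \<Rightarrow> real"
  assumes p: "1 < p"
    and [measurable]: "W \<in> borel_measurable M" "A \<in> borel_measurable M" "B \<in> borel_measurable M"
    and A: "integrable M (\<lambda>x. W x * \<bar>A x\<bar> powr p)"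
    and B: "integrable M (\<lambda>x. W x * \<bar>B x\<bar> powr p)"
  shows "(\<lambda>k. real (Suc k) * ((LINT x|M. W x * \<bar>A x + B x / real (Suc k)\<bar> powr p) - (LINT x|M. W x * \<bar>A x\<bar> powr p)))
     \<longlonglongrightarrow> p * (LINT x|M. W x * (\<bar>A x\<bar> powr (p - 2) * A x) * B x)"
proof -
  define D where "D k x = real (Suc k) * (W x * \<bar>A x + B x / real (Suc k)\<bar> powr p - W x * \<bar>A x\<bar> powr p)" for k x
  have Bk: "integrable M (\<lambda>x. W x * \<bar>B x / real (Suc k)\<bar> powr p)" for k
  proof -
    have "(\<lambda>x. W x * \<bar>B x / real (Suc k)\<bar> powr p) = (\<lambda>x. (W x * \<bar>B x\<bar> powr p) * (1 / real (Suc k)) powr p)"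
      by (auto simp: abs_mult powr_divide)
    then show ?thesis using B by simp
  qed
  have int: "integrable M (\<lambda>x. W x * \<bar>A x + B x / real (Suc k)\<bar> powr p)" for k
    by (rule integrable_weighted_powr_add[OF _ _ _ _ A Bk]) (use p in auto)
  have bound: "integrable M (\<lambda>x. p * 2 powr p * (\<bar>W x * \<bar>A x\<bar> powr p\<bar> + \<bar>W x * \<bar>B x\<bar> powr p\<bar>))"
    using A B by auto
  have lim: "(\<lambda>k. D k x) \<longlonglongrightarrow> p * (W x * (\<bar>A x\<bar> powr (p - 2) * A x) * B x)" for x
  proof -
    let ?f = "\<lambda>r. W x * \<bar>A x + r * B x\<bar> powr p"
    have "((\<lambda>r. \<bar>A x + r * B x\<bar> powr p) has_real_derivative
      p * (\<bar>A x\<bar> powr (p - 2) * A x) * B x) (at 0)"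
      by (rule DERIV_chain'[where f = "\<lambda>r. A x + r * B x" and g = "\<lambda>x. \<bar>x\<bar> powr p",
          OF _ has_real_derivative_abs_powr[OF p], THEN DERIV_cong])
        (auto intro!: derivative_eq_intros)
    then have "(?f has_real_derivative W x * (p * (\<bar>A x\<bar> powr (p - 2) * A x) * B x)) (at 0)"
      by (rule DERIV_cmult)
    then have L: "((\<lambda>h. (?f h - ?f 0) / h) \<longlongrightarrow> W x * (p * (\<bar>A x\<bar> powr (p - 2) * A x) * B x)) (at 0)"
      by (simp add: DERIV_def)
    have F: "filterlim (\<lambda>k. 1 / real (Suc k)) (at 0) sequentially"
      unfolding filterlim_at using LIMSEQ_inverse_real_of_nat by (auto simp: field_simps)
    have "(\<lambda>k. (?f (1 / real (Suc k)) - ?f 0) / (1 / real (Suc k))) \<longlonglongrightarrow> W x * (p * (\<bar>A x\<bar> powr (p - 2) * A x) * B x)"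
      using filterlim_compose[OF L F] .
    then show ?thesis unfolding D_def by (simp add: algebra_simps)
  qed
  have "(\<lambda>k. LINT x|M. D k x) \<longlonglongrightarrow> (LINT x|M. p * (W x * (\<bar>A x\<bar> powr (p - 2) * A x) * B x))"
  proof (rule integral_dominated_convergence[OF _ _ bound])
    show "AE x in M. norm (D k x) \<le> p * 2 powr p * (\<bar>W x * \<bar>A x\<bar> powr p\<bar> + \<bar>W x * \<bar>B x\<bar> powr p\<bar>)" for k
    proof (rule AE_I2)
      fix x
      have "\<bar>\<bar>A x + (1 / real (Suc k)) * B x\<bar> powr p - \<bar>A x\<bar> powr p\<bar>
          \<le> (1 / real (Suc k)) * (p * 2 powr p * (\<bar>A x\<bar> powr p + \<bar>B x\<bar> powr p))"
        by (rule abs_powr_difference_le[OF p]) auto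
      then have "real (Suc k) * \<bar>\<bar>A x + B x / real (Suc k)\<bar> powr p - \<bar>A x\<bar> powr p\<bar>
          \<le> p * 2 powr p * (\<bar>A x\<bar> powr p + \<bar>B x\<bar> powr p)"
        by (simp add: field_simps)
      then have "\<bar>W x\<bar> * (real (Suc k) * \<bar>\<bar>A x + B x / real (Suc k)\<bar> powr p - \<bar>A x\<bar> powr p\<bar>)
          \<le> \<bar>W x\<bar> * (p * 2 powr p * (\<bar>A x\<bar> powr p + \<bar>B x\<bar> powr p))"
        by (rule mult_left_mono) auto
      moreover have "D k x = W x * (real (Suc k) * (\<bar>A x + B x / real (Suc k)\<bar> powr p - \<bar>A x\<bar> powr p))"
        by (simp add: D_def algebra_simps)
      ultimately have "\<bar>D k x\<bar> \<le> \<bar>W x\<bar> * (p * 2 powr p * (\<bar>A x\<bar> powr p + \<bar>B x\<bar> powr p))"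
        by (simp only: abs_mult abs_of_nat abs_idempotent)
      then show "norm (D k x) \<le> p * 2 powr p * (\<bar>W x * \<bar>A x\<bar> powr p\<bar> + \<bar>W x * \<bar>B x\<bar> powr p\<bar>)"
        by (simp add: abs_mult algebra_simps)
    qed
  qed (use lim in \<open>auto simp: D_def\<close>)
  moreover have "(LINT x|M. D k x) = real (Suc k) * ((LINT x|M. W x * \<bar>A x + B x / real (Suc k)\<bar> powr p) - (LINT x|M. W x * \<bar>A x\<bar> powr p))" for k
    unfolding D_def using int[of k] A by (simp del: of_nat_Suc)
  ultimately show ?thesis by simp
qed

text \<open>
  A form of Vitali's theorem: a bound in \<open>L\<^sup>a\<close> with \<open>a > 1\<close> gives uniform integrability. The proof
  truncates at height \<open>L\<close>; the error is at most \<open>L powr (1 - a)\<close> times the bound.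
\<close>
lemma convergent_integrals_of_bounded_powr:
  fixes f :: "nat \<Rightarrow> 'a \<Rightarrow> real"
  assumes M: "finite_measure M" and a: "1 < a"
    and [measurable]: "\<And>k. f k \<in> borel_measurable M" "g \<in> borel_measurable M"
    and lim: "AE x in M. (\<lambda>k. f k x) \<longlonglongrightarrow> g x"
    and bd: "\<And>k. (\<integral>\<^sup>+x. ennreal (\<bar>f k x\<bar> powr a) \<partial>M) \<le> ennreal K"
  shows "integrable M g" "(\<lambda>k. LINT x|M. f k x) \<longlonglongrightarrow> (LINT x|M. g x)"
proof -
  interpret finite_measure M by fact
  have bdg: "(\<integral>\<^sup>+x. ennreal (\<bar>g x\<bar> powr a) \<partial>M) \<le> ennreal K"
  proof -
    have "(\<integral>\<^sup>+x. ennreal (\<bar>g x\<bar> powr a) \<partial>M) = (\<integral>\<^sup>+x. liminf (\<lambda>k. ennreal (\<bar>f k x\<bar> powr a)) \<partial>M)"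
    proof (rule nn_integral_cong_AE, use lim in eventually_elim)
      fix x assume "(\<lambda>k. f k x) \<longlonglongrightarrow> g x"
      then have "(\<lambda>k. \<bar>f k x\<bar> powr a) \<longlonglongrightarrow> \<bar>g x\<bar> powr a"
        using a by (intro tendsto_powr') (auto intro!: tendsto_intros)
      then have "(\<lambda>k. ennreal (\<bar>f k x\<bar> powr a)) \<longlonglongrightarrow> ennreal (\<bar>g x\<bar> powr a)"
        by (intro tendsto_ennrealI)
      then show "ennreal (\<bar>g x\<bar> powr a) = liminf (\<lambda>k. ennreal (\<bar>f k x\<bar> powr a))"
        by (metis lim_imp_Liminf sequentially_bot)
    qed
    also have "\<dots> \<le> liminf (\<lambda>k. \<integral>\<^sup>+x. ennreal (\<bar>f k x\<bar> powr a) \<partial>M)"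
      by (rule nn_integral_liminf) measurable
    also have "\<dots> \<le> ennreal K"
      using bd by (intro Liminf_le) (auto intro!: always_eventually)
    finally show ?thesis .
  qed
  have integrable_of_bd: "integrable M h"
    if [measurable]: "h \<in> borel_measurable M" and h: "(\<integral>\<^sup>+x. ennreal (\<bar>h x\<bar> powr a) \<partial>M) \<le> ennreal K" for h
  proof (rule Bochner_Integration.integrable_bound)
    have "integrable M (\<lambda>x. \<bar>h x\<bar> powr a)"
      using h by (auto simp: integrable_iff_bounded intro: le_less_trans)
    then show "integrable M (\<lambda>x. 1 + \<bar>h x\<bar> powr a)" by simp
    show "AE x in M. norm (h x) \<le> norm (1 + \<bar>h x\<bar> powr a)"
    proof (rule AE_I2)
      fix x
      show "norm (h x) \<le> norm (1 + \<bar>h x\<bar> powr a)"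
        using powr_mono[of 1 a "\<bar>h x\<bar>"] a by (cases "\<bar>h x\<bar> \<le> 1") (auto simp: add_increasing2)
    qed
  qed measurable
  show intg: "integrable M g" by (rule integrable_of_bd[OF _ bdg]) measurable
  have intf: "integrable M (f k)" for k by (rule integrable_of_bd[OF _ bd]) measurable
  have K: "0 \<le> max K 0" by simp
  \<comment> \<open>Truncation of a real number to the interval from \<open>- L\<close> to \<open>L\<close>.\<close>
  define T where "T L x = max (- L) (min L x)" for L x :: real
  have trunc: "\<bar>x - T L x\<bar> \<le> L powr (1 - a) * \<bar>x\<bar> powr a" if "0 < L" for x L
  proof (cases "\<bar>x\<bar> \<le> L")
    case True then show ?thesis using that by (auto simp: T_def max_def min_def)
  next
    case False
    have "\<bar>x - T L x\<bar> \<le> \<bar>x\<bar>" using that by (auto simp: T_def max_def min_def)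
    also have "\<dots> = \<bar>x\<bar> powr (1 - a) * \<bar>x\<bar> powr a"
      using False that by (auto simp flip: powr_add)
    also have "\<dots> \<le> L powr (1 - a) * \<bar>x\<bar> powr a"
      using False that a by (intro mult_right_mono powr_mono2') auto
    finally show ?thesis .
  qed
  have Tm [measurable]: "T L \<in> borel_measurable borel" for L unfolding T_def by measurable
  have Tint: "integrable M (\<lambda>x. T L (h x))" if "h \<in> borel_measurable M" for h L
    using that by (intro integrable_const_bound[where B = "\<bar>L\<bar>"]) (auto simp: T_def)
  have diff: "\<bar>(LINT x|M. h x) - (LINT x|M. T L (h x))\<bar> \<le> L powr (1 - a) * max K 0"
    if hm: "h \<in> borel_measurable M" and h: "(\<integral>\<^sup>+x. ennreal (\<bar>h x\<bar> powr a) \<partial>M) \<le> ennreal K" and L: "0 < L" for h L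
  proof -
    note [measurable] = hm
    have hi: "integrable M h" by (rule integrable_of_bd[OF hm h])
    have ha: "integrable M (\<lambda>x. \<bar>h x\<bar> powr a)" using h by (auto simp: integrable_iff_bounded intro: le_less_trans)
    have "ennreal (LINT x|M. \<bar>h x\<bar> powr a) \<le> ennreal K"
      using h ha by (simp add: nn_integral_eq_integral)
    then have le: "(LINT x|M. \<bar>h x\<bar> powr a) \<le> max K 0"
      by (simp add: ennreal_le_iff2) linarith
    have "\<bar>(LINT x|M. h x) - (LINT x|M. T L (h x))\<bar> = \<bar>LINT x|M. h x - T L (h x)\<bar>"
      using hi Tint[OF hm] by simp
    also have "\<dots> \<le> (LINT x|M. L powr (1 - a) * \<bar>h x\<bar> powr a)"
      using hi Tint[OF hm] ha trunc[OF L]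
      by (intro order_trans[OF integral_abs_bound] integral_mono) auto
    also have "\<dots> \<le> L powr (1 - a) * max K 0" using le by (simp add: mult_left_mono)
    finally show ?thesis .
  qed
  show "(\<lambda>k. LINT x|M. f k x) \<longlonglongrightarrow> (LINT x|M. g x)"
  proof (rule LIMSEQ_I)
    fix e :: real assume e: "0 < e"
    have "((\<lambda>L. L powr (1 - a) * max K 0) \<longlongrightarrow> 0 * max K 0) at_top"
      using a by (intro tendsto_mult tendsto_neg_powr filterlim_ident tendsto_const) auto
    then have "eventually (\<lambda>L. L powr (1 - a) * max K 0 < e / 3) at_top"
      using e by (intro order_tendstoD(2)) auto
    then obtain L0 where "\<And>L. L0 \<le> L \<Longrightarrow> L powr (1 - a) * max K 0 < e / 3"
      by (auto simp: eventually_at_top_linorder)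
    then obtain L where L: "0 < L" "L powr (1 - a) * max K 0 < e / 3"
      by (meson max.cobounded1 max.cobounded2 less_le_trans zero_less_one)
    have "(\<lambda>k. LINT x|M. T L (f k x)) \<longlonglongrightarrow> (LINT x|M. T L (g x))"
    proof (rule integral_dominated_convergence[where w = "\<lambda>_. \<bar>L\<bar>"])
      show "AE x in M. (\<lambda>k. T L (f k x)) \<longlonglongrightarrow> T L (g x)"
        using lim by eventually_elim (auto simp: T_def intro!: tendsto_intros)
    qed (auto simp: T_def)
    then obtain k0 where k0: "\<And>k. k \<ge> k0 \<Longrightarrow> norm ((LINT x|M. T L (f k x)) - (LINT x|M. T L (g x))) < e / 3"
      using LIMSEQ_D e by (metis divide_pos_pos zero_less_numeral)
    show "\<exists>no. \<forall>k\<ge>no. norm ((LINT x|M. f k x) - (LINT x|M. g x)) < e"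
    proof (intro exI allI impI)
      fix k assume "k0 \<le> k"
      then have "\<bar>(LINT x|M. T L (f k x)) - (LINT x|M. T L (g x))\<bar> < e / 3" using k0 by simp
      moreover have "\<bar>(LINT x|M. f k x) - (LINT x|M. T L (f k x))\<bar> < e / 3"
        by (rule le_less_trans[OF diff[OF _ bd L(1)] L(2)]) measurable
      moreover have "\<bar>(LINT x|M. g x) - (LINT x|M. T L (g x))\<bar> < e / 3"
        by (rule le_less_trans[OF diff[OF _ bdg L(1)] L(2)]) measurable
      ultimately show "norm ((LINT x|M. f k x) - (LINT x|M. g x)) < e"
        by (simp only: real_norm_def)
    qed
  qed
qed

section \<open>Higher integrability\<close>

text \<open>
  The basic gain of integrability. The set \<open>S\<close> where \<open>\<bar>u\<bar> \<ge> \<bar>u x\<bar> / 2\<close> has measure at most \<open>\<mu>\<close>; the ball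
  about \<open>x\<close> of measure \<open>2 * \<mu>\<close> therefore contains a set of measure at least \<open>\<mu>\<close> on which
  \<open>\<bar>u x - u y\<bar> \<ge> \<bar>u x\<bar> / 2\<close>, and this part alone contributes the stated amount to \<open>gag_density\<close>.
\<close>

lemma powr_le_gag_density:
  fixes u :: "real ^ 'n \<Rightarrow> real" and x :: "real ^ 'n" and s p m B :: real
  defines "t \<equiv> s * p / real CARD('n)" and "\<omega> \<equiv> unit_ball_vol (real CARD('n))"
  assumes s: "0 < s" and p: "0 < p" and m: "0 < m" and B: "0 < B"
    and [measurable]: "u \<in> borel_measurable lebesgue"
    and bd: "(\<integral>\<^sup>+y. ennreal (\<bar>u y\<bar> powr (p * m)) \<partial>lebesgue) \<le> ennreal B"
  shows "ennreal (\<bar>u x\<bar> powr (p * (1 + t * m)))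
    \<le> ennreal (2 powr (p * (1 + t * m)) * (2 / \<omega>) powr (1 + t) * B powr t) * gag_density s p u x"
proof (cases "u x = 0")
  case False
  define N where "N = real CARD('n)"
  have N: "0 < N" by (simp add: N_def)
  have t: "0 < t" using s p N by (simp add: t_def N_def)
  have \<omega>: "0 < \<omega>" by (simp add: \<omega>_def)
  define a where "a = \<bar>u x\<bar>"
  have a: "0 < a" using False by (simp add: a_def)
  define \<mu> where "\<mu> = B / (a / 2) powr (p * m)"
  have \<mu>: "0 < \<mu>" using a B by (simp add: \<mu>_def)
  define S where "S = {y. a / 2 \<le> \<bar>u y\<bar>}"
  have "{y \<in> space lebesgue. a / 2 \<le> \<bar>u y\<bar>} \<in> sets lebesgue" by measurable
  then have S [measurable]: "S \<in> sets lebesgue" by (simp add: S_def)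
  have "emeasure lebesgue S = (\<integral>\<^sup>+y. indicator S y \<partial>lebesgue)" by simp
  also have "\<dots> \<le> (\<integral>\<^sup>+y. ennreal (1 / (a / 2) powr (p * m)) * ennreal (\<bar>u y\<bar> powr (p * m)) \<partial>lebesgue)"
  proof (rule nn_integral_mono)
    fix y
    show "indicator S y \<le> ennreal (1 / (a / 2) powr (p * m)) * ennreal (\<bar>u y\<bar> powr (p * m))"
    proof (cases "y \<in> S")
      case True
      then have "(a / 2) powr (p * m) \<le> \<bar>u y\<bar> powr (p * m)"
        using a p m by (intro powr_mono2) (auto simp: S_def)
      then have "1 \<le> 1 / (a / 2) powr (p * m) * \<bar>u y\<bar> powr (p * m)"
        using a by (simp add: field_simps)
      then have "ennreal 1 \<le> ennreal (1 / (a / 2) powr (p * m) * \<bar>u y\<bar> powr (p * m))"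
        by (rule ennreal_leI)
      then show ?thesis using True by (simp flip: ennreal_mult'')
    qed simp
  qed
  also have "\<dots> = ennreal (1 / (a / 2) powr (p * m)) * (\<integral>\<^sup>+y. ennreal (\<bar>u y\<bar> powr (p * m)) \<partial>lebesgue)"
    by (rule nn_integral_cmult) measurable
  also have "\<dots> \<le> ennreal (1 / (a / 2) powr (p * m)) * ennreal B"
    by (intro mult_left_mono bd) simp
  also have "\<dots> = ennreal \<mu>" using B by (simp add: \<mu>_def flip: ennreal_mult'')
  finally have eS: "emeasure lebesgue S \<le> ennreal \<mu>" .
  \<comment> \<open>With this radius the ball has measure \<open>2 * \<mu>\<close>, twice the bound for \<open>S\<close>.\<close>
  define r where "r = (2 * \<mu> / \<omega>) powr (1 / N)"
  have r: "0 < r" using \<mu> \<omega> by (simp add: r_def)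
  have "\<omega> * r powr N = 2 * \<mu>" using \<mu> \<omega> N by (simp add: r_def powr_powr)
  then have eb: "emeasure lebesgue (ball x r) = ennreal \<mu> + ennreal \<mu>"
    using emeasure_lebesgue_ball[of r x] r \<mu> by (simp add: \<omega>_def N_def flip: ennreal_plus)
  define T where "T = ball x r - S"
  have T [measurable]: "T \<in> sets lebesgue" unfolding T_def using S by (intro sets.Diff) auto
  have "emeasure lebesgue (ball x r) \<le> emeasure lebesgue (S \<union> T)"
    by (rule emeasure_mono) (auto simp: T_def)
  also have "\<dots> \<le> emeasure lebesgue S + emeasure lebesgue T"
    by (rule emeasure_subadditive) auto
  also have "\<dots> \<le> ennreal \<mu> + emeasure lebesgue T" using eS by (rule add_right_mono)
  finally have eT: "ennreal \<mu> \<le> emeasure lebesgue T"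
    unfolding eb by (simp add: ennreal_add_left_cancel_le)
  define \<kappa> where "\<kappa> = (a / 2) powr p / r powr (N + s * p)"
  have \<kappa>: "0 < \<kappa>" using a r by (simp add: \<kappa>_def)
  have "ennreal (\<kappa> * \<mu>) \<le> ennreal \<kappa> * emeasure lebesgue T"
    using eT \<kappa> by (simp add: ennreal_mult' mult_left_mono)
  also have "\<dots> = (\<integral>\<^sup>+y. ennreal \<kappa> * indicator T y \<partial>lebesgue)"
    by (simp add: nn_integral_cmult_indicator)
  also have "\<dots> \<le> gag_density s p u x"
    unfolding gag_density_def
  proof (rule nn_integral_mono)
    fix y
    show "ennreal \<kappa> * indicator T y \<le> ennreal (gagliardo_quot s p u (x, y))"
    proof (cases "y \<in> T")
      case True
      then have y: "norm (x - y) < r" "\<bar>u y\<bar> < a / 2" by (auto simp: T_def S_def dist_norm)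
      then have "x \<noteq> y" using a by (auto simp: a_def)
      have "a / 2 \<le> \<bar>u x - u y\<bar>" using y(2) unfolding a_def by linarith
      then have "(a / 2) powr p \<le> \<bar>u x - u y\<bar> powr p" using a p by (intro powr_mono2) auto
      moreover have "norm (x - y) powr (N + s * p) \<le> r powr (N + s * p)"
        using y s p N by (intro powr_mono2) auto
      ultimately have "\<kappa> \<le> \<bar>u x - u y\<bar> powr p / norm (x - y) powr (N + s * p)"
        unfolding \<kappa>_def using \<open>x \<noteq> y\<close> by (intro frac_le) auto
      then show ?thesis using True by (auto simp: gagliardo_quot_def N_def intro!: ennreal_leI)
    qed simp
  qed
  finally have G: "ennreal (\<kappa> * \<mu>) \<le> gag_density s p u x" .
  let ?C = "2 powr (p * (1 + t * m)) * (2 / \<omega>) powr (1 + t) * B powr t"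
  have Nsp: "(N + s * p) / N = 1 + t" using N by (simp add: t_def N_def field_simps)
  have "r powr (N + s * p) = (2 * \<mu> / \<omega>) powr (1 + t)"
    by (simp add: r_def powr_powr Nsp)
  then have "ln (?C * (\<kappa> * \<mu>)) = ln (a powr (p * (1 + t * m)))"
    using a \<mu> \<omega> B by (simp add: \<kappa>_def \<mu>_def ln_mult ln_div ln_powr powr_def) (simp add: field_simps ln_mult ln_div)
  then have "?C * (\<kappa> * \<mu>) = a powr (p * (1 + t * m))"
    using a \<mu> \<kappa> \<omega> B by (subst (asm) ln_inj_iff) auto
  then have "ennreal (\<bar>u x\<bar> powr (p * (1 + t * m))) = ennreal ?C * ennreal (\<kappa> * \<mu>)"
    using \<kappa> \<mu> by (simp add: a_def flip: ennreal_mult'')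
  also have "\<dots> \<le> ennreal ?C * gag_density s p u x"
    by (intro mult_left_mono G) simp
  finally show ?thesis .
qed simp

text \<open>
  The power \<open>(m - 1) / t\<close> of the energy is the one that the iteration \<open>m \<mapsto> 1 + t * m\<close> produces: if
  the exponent for \<open>m\<close> is \<open>e\<close>, the exponent for \<open>1 + t * m\<close> is \<open>1 + t * e\<close>.
\<close>
lemma higher_integrability:
  fixes s p Q :: real
  defines "t \<equiv> s * p / real CARD('n)"
  assumes s: "0 < s" and p: "0 < p" and Q: "1 < Q" "(1 - t) * Q < 1"
  shows "\<exists>m>Q. \<exists>C>0. \<forall>(u :: real ^ 'n \<Rightarrow> real) g. u \<in> borel_measurable lebesgue \<longrightarrow> 1 \<le> g \<longrightarrow>
    (\<integral>\<^sup>+x. ennreal (\<bar>u x\<bar> powr p) \<partial>lebesgue) \<le> 1 \<longrightarrow> gag_energy s p u \<le> ennreal g \<longrightarrow>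
    (\<integral>\<^sup>+x. ennreal (\<bar>u x\<bar> powr (p * m)) \<partial>lebesgue) \<le> ennreal (C * g powr ((m - 1) / t))"
proof -
  let ?P = "\<lambda>m C. 0 < C \<and> (\<forall>(u :: real ^ 'n \<Rightarrow> real) g. u \<in> borel_measurable lebesgue \<longrightarrow> 1 \<le> g \<longrightarrow>
    (\<integral>\<^sup>+x. ennreal (\<bar>u x\<bar> powr p) \<partial>lebesgue) \<le> 1 \<longrightarrow> gag_energy s p u \<le> ennreal g \<longrightarrow>
    (\<integral>\<^sup>+x. ennreal (\<bar>u x\<bar> powr (p * m)) \<partial>lebesgue) \<le> ennreal (C * g powr ((m - 1) / t)))"
  have t: "0 < t" using s p by (simp add: t_def)
  define \<omega> where "\<omega> = unit_ball_vol (real CARD('n))"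
  have \<omega>: "0 < \<omega>" by (simp add: \<omega>_def)
  \<comment> \<open>As long as \<open>m \<le> Q\<close>, one step of the iteration increases \<open>m\<close> by at least \<open>\<delta>\<close>.\<close>
  define \<delta> where "\<delta> = min 1 (1 - (1 - t) * Q)"
  have \<delta>: "0 < \<delta>" using Q by (simp add: \<delta>_def)
  have step: "\<exists>C. ?P (1 + t * m) C" if m: "1 \<le> m" and C: "?P m C" for m C
  proof -
    define C' where "C' = 2 powr (p * (1 + t * m)) * (2 / \<omega>) powr (1 + t) * C powr t"
    have "(\<integral>\<^sup>+x. ennreal (\<bar>u x\<bar> powr (p * (1 + t * m))) \<partial>lebesgue) \<le> ennreal (C' * g powr m)"
      if [measurable]: "u \<in> borel_measurable lebesgue" and g: "1 \<le> g"
        and u: "(\<integral>\<^sup>+x. ennreal (\<bar>u x\<bar> powr p) \<partial>lebesgue) \<le> 1" "gag_energy s p u \<le> ennreal g"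
      for u :: "real ^ 'n \<Rightarrow> real" and g
    proof -
      let ?K = "2 powr (p * (1 + t * m)) * (2 / \<omega>) powr (1 + t) * (C * g powr ((m - 1) / t)) powr t"
      have "(\<integral>\<^sup>+x. ennreal (\<bar>u x\<bar> powr (p * m)) \<partial>lebesgue) \<le> ennreal (C * g powr ((m - 1) / t))"
        using C that by blast
      then have "ennreal (\<bar>u x\<bar> powr (p * (1 + t * m))) \<le> ennreal ?K * gag_density s p u x" for x
        using C m g s p unfolding t_def \<omega>_def by (intro powr_le_gag_density) auto
      then have "(\<integral>\<^sup>+x. ennreal (\<bar>u x\<bar> powr (p * (1 + t * m))) \<partial>lebesgue)
          \<le> (\<integral>\<^sup>+x. ennreal ?K * gag_density s p u x \<partial>lebesgue)"
        by (intro nn_integral_mono)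
      also have "\<dots> = ennreal ?K * gag_energy s p u"
        unfolding gag_energy_def by (rule nn_integral_cmult) measurable
      also have "\<dots> \<le> ennreal ?K * ennreal g" by (intro mult_left_mono u) simp
      also have "\<dots> = ennreal (?K * g)" using g by (simp add: ennreal_mult'')
      also have "?K * g = C' * g powr m"
        using C g t m by (simp add: C'_def powr_mult powr_powr powr_diff)
      finally show ?thesis .
    qed
    moreover have "0 < C'" using C \<omega> by (simp add: C'_def)
    ultimately show ?thesis using t by (intro exI[of _ C']) auto
  qed
  have "\<exists>m\<ge>1. (\<exists>C. ?P m C) \<and> (Q < m \<or> 1 + real k * \<delta> \<le> m)" for k
  proof (induction k)
    case 0
    have "\<exists>C. ?P 1 C" by (rule exI[of _ 1]) simp
    then show ?case by (intro exI[of _ "1::real"] conjI disjI2) simp_all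
  next
    case (Suc k)
    then obtain m C where m: "1 \<le> m" "?P m C" and alt: "Q < m \<or> 1 + real k * \<delta> \<le> m" by blast
    show ?case
    proof (cases "Q < m")
      case True then show ?thesis using m by blast
    next
      case False
      have "(1 - t) * m \<le> max 0 ((1 - t) * Q)"
      proof (cases "t \<le> 1")
        case True
        then have "(1 - t) * m \<le> (1 - t) * Q" using False by (intro mult_left_mono) auto
        then show ?thesis by simp
      next
        case False
        then have "(1 - t) * m \<le> 0" using m(1) by (intro mult_nonpos_nonneg) auto
        then show ?thesis by simp
      qed
      then have "m + \<delta> \<le> 1 + t * m" by (auto simp: \<delta>_def algebra_simps max_def min_def split: if_splits)
      moreover have "1 + real k * \<delta> \<le> m" using alt False by auto
      ultimately have "1 + real (Suc k) * \<delta> \<le> 1 + t * m" by (simp add: algebra_simps)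
      then show ?thesis using step[OF m] m(1) t by (intro exI[of _ "1 + t * m"]) auto
    qed
  qed
  moreover obtain k where "Q < real k * \<delta>" using reals_Archimedean3[OF \<delta>] by blast
  ultimately obtain m where "1 \<le> m" "\<exists>C. ?P m C" "Q < m \<or> 1 + real k * \<delta> \<le> m" by blast
  then show ?thesis using \<open>Q < real k * \<delta>\<close> by (intro exI[of _ m]) auto
qed

section \<open>Control of the potential by the energy\<close>

text \<open>
  Young's inequality for \<open>v * w\<close> as a product of powers of \<open>v powr q\<close>, \<open>w\<close> and \<open>w powr m / Z\<close> with
  exponents \<open>1 / q\<close>, \<open>\<alpha>\<close> and \<open>\<beta>\<close> adding up to 1. The scale \<open>Z\<close> enters through
  \<open>\<beta> = 1 / (q * (m - 1))\<close> only.
\<close>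

lemma scaled_young:
  fixes v w Z q m :: real
  assumes v: "0 \<le> v" and w: "0 \<le> w" and Z: "0 < Z" and q: "1 < q" and m: "q / (q - 1) \<le> m"
  shows "v * w \<le> Z powr (1 / (q * (m - 1))) * (v powr q + w + w powr m / Z)"
proof (cases "v = 0 \<or> w = 0")
  case True
  then show ?thesis using v w Z by auto
next
  case False
  then have v: "0 < v" and w: "0 < w" using v w by auto
  have "q / (q - 1) = 1 + 1 / (q - 1)" using q by (simp add: field_simps)
  then have m1: "1 / (q - 1) \<le> m - 1" using m by simp
  then have m1': "0 < m - 1" using q by (smt (verit) zero_less_divide_1_iff)
  define \<beta> where "\<beta> = 1 / (q * (m - 1))"
  have \<beta>: "0 < \<beta>" using q m1' by (simp add: \<beta>_def)
  have "1 / (m - 1) \<le> q - 1" using m1 m1' q by (simp add: field_simps)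
  then have "1 / (m - 1) * (1 / q) \<le> (q - 1) * (1 / q)" using q by (intro mult_right_mono) auto
  then have "\<beta> \<le> 1 - 1 / q" using q by (simp add: \<beta>_def diff_divide_distrib mult.commute)
  define \<alpha> where "\<alpha> = 1 - 1 / q - \<beta>"
  have \<alpha>: "0 \<le> \<alpha>" using \<open>\<beta> \<le> _\<close> by (simp add: \<alpha>_def)
  have \<alpha>\<beta>: "\<alpha> + m * \<beta> = 1"
  proof -
    have "(m - 1) * \<beta> = 1 / q" using m1' by (simp add: \<beta>_def)
    then show ?thesis by (simp add: \<alpha>_def algebra_simps)
  qed
  define T where "T = v powr q + w + w powr m / Z"
  have T: "0 < T" "v powr q \<le> T" "w \<le> T" "w powr m / Z \<le> T"
    using v w Z by (auto simp: T_def add_pos_pos)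
  have "v = (v powr q) powr (1 / q)" using v q by (simp add: powr_powr)
  also have "\<dots> \<le> T powr (1 / q)" using T q by (intro powr_mono2) auto
  finally have 1: "v \<le> T powr (1 / q)" .
  have 2: "w powr \<alpha> \<le> T powr \<alpha>" using T w \<alpha> by (intro powr_mono2) auto
  have 3: "(w powr m / Z) powr \<beta> \<le> T powr \<beta>" using T w \<beta> Z by (intro powr_mono2) auto
  have "v * w powr \<alpha> * (w powr m / Z) powr \<beta> \<le> T powr (1 / q) * T powr \<alpha> * T powr \<beta>"
    using v by (intro mult_mono 1 2 3) auto
  also have "\<dots> = T" using T by (simp add: \<alpha>_def flip: powr_add)
  also have "v * w powr \<alpha> * (w powr m / Z) powr \<beta> = v * w / Z powr \<beta>"
    using w Z \<alpha>\<beta> by (simp add: powr_divide powr_powr flip: powr_add)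
  finally show ?thesis using Z by (simp add: T_def \<beta>_def field_simps)
qed

lemma product_powr_le_sum:
  fixes v w q m :: real
  assumes v: "0 \<le> v" and w: "0 \<le> w" and q: "1 < q" and m: "q / (q - 1) < m"
  defines "a \<equiv> 1 / (1 / q + 1 / m)"
  shows "1 < a" "(v * w) powr a \<le> v powr q + w powr m"
proof -
  have m0: "0 < m" using m q by (smt (verit) divide_pos_pos)
  have "q < m * (q - 1)" using m q by (simp add: field_simps)
  then have "1 / q + 1 / m < 1" using q m0 by (simp add: field_simps)
  moreover have pos: "0 < 1 / q + 1 / m" using q m0 by (simp add: add_pos_pos)
  ultimately show a: "1 < a" by (simp add: a_def)
  define T where "T = v powr q + w powr m"
  have T: "v powr q \<le> T" "w powr m \<le> T" "0 \<le> T" by (auto simp: T_def)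
  have "v = (v powr q) powr (1 / q)" using v q by (simp add: powr_powr)
  also have "\<dots> \<le> T powr (1 / q)" using T q by (intro powr_mono2) auto
  finally have 1: "v \<le> T powr (1 / q)" .
  have "w = (w powr m) powr (1 / m)" using w m0 by (simp add: powr_powr)
  also have "\<dots> \<le> T powr (1 / m)" using T m0 by (intro powr_mono2) auto
  finally have 2: "w \<le> T powr (1 / m)" .
  have "(v * w) powr a \<le> (T powr (1 / q) * T powr (1 / m)) powr a"
    using a v w by (intro powr_mono2 mult_mono 1 2) auto
  also have "\<dots> = T powr ((1 / q + 1 / m) * a)" by (simp add: powr_powr flip: powr_add)
  also have "(1 / q + 1 / m) * a = 1" using pos by (simp add: a_def)
  finally show "(v * w) powr a \<le> v powr q + w powr m" using T by (simp add: T_def)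
qed

lemma nn_integral_lebesgue_on_le:
  fixes f :: "'a::euclidean_space \<Rightarrow> ennreal"
  assumes "\<Omega> \<in> sets lebesgue"
  shows "(\<integral>\<^sup>+x. f x \<partial>lebesgue_on \<Omega>) \<le> (\<integral>\<^sup>+x. f x \<partial>lebesgue)"
  using assms by (subst nn_integral_restrict_space) (auto intro!: nn_integral_mono simp: indicator_def)

text \<open>
  For \<open>u\<close> of norm at most 1 with \<open>gag_energy s p u \<le> g\<close>, the integral of \<open>\<bar>V\<bar> * \<bar>u\<bar> powr p\<close> is
  sublinear in \<open>g\<close>: taking \<open>Z = g powr ((m - 1) / t)\<close> in \<open>scaled_young\<close>, the factor is
  \<open>g powr (1 / (q * t))\<close>. The second part, with \<open>V\<close> replaced by 1, also covers \<open>\<bar>u\<bar> powr p\<close> itself.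
\<close>
lemma potential_energy_bound:
  fixes s p q :: real and \<Omega> :: "(real ^ 'n) set" and V :: "real ^ 'n \<Rightarrow> real"
  assumes s: "0 < s" and p: "0 < p" and q: "1 < q" "real CARD('n) / (s * p) < q"
    and \<Omega>: "\<Omega> \<in> sets lebesgue" and V: "V \<in> Lp q \<Omega>"
  shows "\<exists>C>0. \<exists>\<theta>. 0 < \<theta> \<and> \<theta> < 1 \<and> (\<forall>(u :: real ^ 'n \<Rightarrow> real) g. u \<in> borel_measurable lebesgue \<longrightarrow> 1 \<le> g \<longrightarrow>
    (\<integral>\<^sup>+x. ennreal (\<bar>u x\<bar> powr p) \<partial>lebesgue) \<le> 1 \<longrightarrow> gag_energy s p u \<le> ennreal g \<longrightarrow>
    (\<integral>\<^sup>+x. ennreal (\<bar>V x\<bar> * \<bar>u x\<bar> powr p) \<partial>lebesgue_on \<Omega>) \<le> ennreal (C * g powr \<theta>))"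
    (is ?thesis1)
  and "\<exists>a>1. \<forall>g\<ge>1. \<exists>K. \<forall>u :: real ^ 'n \<Rightarrow> real. u \<in> borel_measurable lebesgue \<longrightarrow>
    (\<integral>\<^sup>+x. ennreal (\<bar>u x\<bar> powr p) \<partial>lebesgue) \<le> 1 \<longrightarrow> gag_energy s p u \<le> ennreal g \<longrightarrow>
    (\<integral>\<^sup>+x. ennreal (\<bar>V x * \<bar>u x\<bar> powr p\<bar> powr a) \<partial>lebesgue_on \<Omega>) \<le> ennreal K"
    (is ?thesis2)
proof -
  define t where "t = s * p / real CARD('n)"
  have t: "0 < t" using s p by (simp add: t_def)
  have qt: "1 < q * t" using q(2) s p by (simp add: t_def field_simps)
  have Q: "1 < q / (q - 1)" "(1 - t) * (q / (q - 1)) < 1"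
    using q(1) qt by (auto simp: field_simps)
  obtain m C where m: "q / (q - 1) < m" and C: "0 < C" and
    hi: "\<And>(u :: real ^ 'n \<Rightarrow> real) g. u \<in> borel_measurable lebesgue \<Longrightarrow> 1 \<le> g \<Longrightarrow>
    (\<integral>\<^sup>+x. ennreal (\<bar>u x\<bar> powr p) \<partial>lebesgue) \<le> 1 \<Longrightarrow> gag_energy s p u \<le> ennreal g \<Longrightarrow>
    (\<integral>\<^sup>+x. ennreal (\<bar>u x\<bar> powr (p * m)) \<partial>lebesgue) \<le> ennreal (C * g powr ((m - 1) / t))"
    using higher_integrability[OF s p Q(1), where 'n = 'n] Q(2) unfolding t_def by blast
  have m1: "1 < m" using Q m by simp
  have [measurable]: "V \<in> borel_measurable (lebesgue_on \<Omega>)" using V by (simp add: Lp_def)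
  have "(\<integral>\<^sup>+x. ennreal (\<bar>V x\<bar> powr q) \<partial>lebesgue_on \<Omega>) < \<infinity>"
    using V by (simp add: Lp_def integrable_iff_bounded)
  then obtain A where A: "0 \<le> A" "(\<integral>\<^sup>+x. ennreal (\<bar>V x\<bar> powr q) \<partial>lebesgue_on \<Omega>) = ennreal A"
    by (cases "\<integral>\<^sup>+x. ennreal (\<bar>V x\<bar> powr q) \<partial>lebesgue_on \<Omega>") auto
  have meas: "u \<in> borel_measurable (lebesgue_on \<Omega>)" if "u \<in> borel_measurable lebesgue" for u :: "real ^ 'n \<Rightarrow> real"
    by (rule measurable_restrict_space1[OF that])
  show ?thesis1
  proof (intro exI conjI allI impI)
    show "0 < A + 1 + C" using A C by simp
    show "0 < 1 / (q * t)" "1 / (q * t) < 1" using q t qt by auto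
    fix u :: "real ^ 'n \<Rightarrow> real" and g :: real
    assume um [measurable]: "u \<in> borel_measurable lebesgue" and g: "1 \<le> g" and
      u1: "(\<integral>\<^sup>+x. ennreal (\<bar>u x\<bar> powr p) \<partial>lebesgue) \<le> 1" and uE: "gag_energy s p u \<le> ennreal g"
    note [measurable] = meas[OF um]
    define Z where "Z = g powr ((m - 1) / t)"
    have Z: "0 < Z" using g by (simp add: Z_def)
    have Zp: "Z powr (1 / (q * (m - 1))) = g powr (1 / (q * t))"
      using m1 by (simp add: Z_def powr_powr mult.commute)
    have "(\<integral>\<^sup>+x. ennreal (\<bar>V x\<bar> * \<bar>u x\<bar> powr p) \<partial>lebesgue_on \<Omega>)
      \<le> (\<integral>\<^sup>+x. ennreal (g powr (1 / (q * t))) * (ennreal (\<bar>V x\<bar> powr q) + ennreal (\<bar>u x\<bar> powr p)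
            + ennreal (1 / Z) * ennreal (\<bar>u x\<bar> powr (p * m))) \<partial>lebesgue_on \<Omega>)"
    proof (rule nn_integral_mono)
      fix x
      have "\<bar>V x\<bar> * \<bar>u x\<bar> powr p \<le> g powr (1 / (q * t)) * (\<bar>V x\<bar> powr q + \<bar>u x\<bar> powr p + \<bar>u x\<bar> powr (p * m) / Z)"
        using scaled_young[of "\<bar>V x\<bar>" "\<bar>u x\<bar> powr p" Z q m] Z q m by (simp add: Zp powr_powr)
      then have "ennreal (\<bar>V x\<bar> * \<bar>u x\<bar> powr p)
        \<le> ennreal (g powr (1 / (q * t)) * (\<bar>V x\<bar> powr q + \<bar>u x\<bar> powr p + \<bar>u x\<bar> powr (p * m) / Z))"
        by (rule ennreal_leI)
      also have "\<dots> = ennreal (g powr (1 / (q * t))) * (ennreal (\<bar>V x\<bar> powr q) + ennreal (\<bar>u x\<bar> powr p)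
            + ennreal (1 / Z) * ennreal (\<bar>u x\<bar> powr (p * m)))"
        using Z by (simp flip: ennreal_mult'' ennreal_plus)
      finally show "ennreal (\<bar>V x\<bar> * \<bar>u x\<bar> powr p) \<le> \<dots>" .
    qed
    also have "\<dots> = ennreal (g powr (1 / (q * t))) * (ennreal A
      + (\<integral>\<^sup>+x. ennreal (\<bar>u x\<bar> powr p) \<partial>lebesgue_on \<Omega>)
      + ennreal (1 / Z) * (\<integral>\<^sup>+x. ennreal (\<bar>u x\<bar> powr (p * m)) \<partial>lebesgue_on \<Omega>))"
      by (simp add: nn_integral_cmult nn_integral_add A)
    also have "\<dots> \<le> ennreal (g powr (1 / (q * t))) * (ennreal A + 1 + ennreal (1 / Z) * ennreal (C * Z))"
      using order_trans[OF nn_integral_lebesgue_on_le[OF \<Omega>] u1]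
        order_trans[OF nn_integral_lebesgue_on_le[OF \<Omega>] hi[OF um g u1 uE]]
      by (intro mult_left_mono add_mono order_refl) (auto simp: Z_def)
    also have "\<dots> = ennreal ((A + 1 + C) * g powr (1 / (q * t)))"
    proof -
      have "ennreal (1 / Z) * ennreal (C * Z) = ennreal C"
        using Z C by (simp flip: ennreal_mult'')
      then show ?thesis using A C by (simp add: mult.commute flip: ennreal_mult'' ennreal_plus ennreal_1)
    qed
    finally show "(\<integral>\<^sup>+x. ennreal (\<bar>V x\<bar> * \<bar>u x\<bar> powr p) \<partial>lebesgue_on \<Omega>)
      \<le> ennreal ((A + 1 + C) * g powr (1 / (q * t)))" .
  qed
  define a where "a = 1 / (1 / q + 1 / m)"
  have a: "1 < a" "\<And>v w. 0 \<le> v \<Longrightarrow> 0 \<le> w \<Longrightarrow> (v * w) powr a \<le> v powr q + w powr m"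
    using product_powr_le_sum[OF _ _ q(1) m] unfolding a_def by auto
  show ?thesis2
  proof (intro exI conjI allI impI)
    show "1 < a" by fact
    fix u :: "real ^ 'n \<Rightarrow> real" and g :: real
    assume g: "1 \<le> g" and um [measurable]: "u \<in> borel_measurable lebesgue" and
      u1: "(\<integral>\<^sup>+x. ennreal (\<bar>u x\<bar> powr p) \<partial>lebesgue) \<le> 1" and uE: "gag_energy s p u \<le> ennreal g"
    note [measurable] = meas[OF um]
    have "(\<integral>\<^sup>+x. ennreal (\<bar>V x * \<bar>u x\<bar> powr p\<bar> powr a) \<partial>lebesgue_on \<Omega>)
      \<le> (\<integral>\<^sup>+x. ennreal (\<bar>V x\<bar> powr q) + ennreal (\<bar>u x\<bar> powr (p * m)) \<partial>lebesgue_on \<Omega>)"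
    proof (rule nn_integral_mono)
      fix x
      have "\<bar>V x * \<bar>u x\<bar> powr p\<bar> powr a \<le> \<bar>V x\<bar> powr q + \<bar>u x\<bar> powr (p * m)"
        using a(2)[of "\<bar>V x\<bar>" "\<bar>u x\<bar> powr p"] by (simp add: abs_mult powr_powr)
      then show "ennreal (\<bar>V x * \<bar>u x\<bar> powr p\<bar> powr a) \<le> ennreal (\<bar>V x\<bar> powr q) + ennreal (\<bar>u x\<bar> powr (p * m))"
        by (simp flip: ennreal_plus)
    qed
    also have "\<dots> = ennreal A + (\<integral>\<^sup>+x. ennreal (\<bar>u x\<bar> powr (p * m)) \<partial>lebesgue_on \<Omega>)"
      by (simp add: nn_integral_add A)
    also have "\<dots> \<le> ennreal A + ennreal (C * g powr ((m - 1) / t))"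
      using order_trans[OF nn_integral_lebesgue_on_le[OF \<Omega>] hi[OF um g u1 uE]] by (rule add_left_mono)
    also have "\<dots> = ennreal (A + C * g powr ((m - 1) / t))" using A C by (simp flip: ennreal_plus)
    finally show "(\<integral>\<^sup>+x. ennreal (\<bar>V x * \<bar>u x\<bar> powr p\<bar> powr a) \<partial>lebesgue_on \<Omega>)
      \<le> ennreal (A + C * g powr ((m - 1) / t))" .
  qed
qed

section \<open>Compactness\<close>

lemma L1_Cauchy_AE_subseq:
  fixes v :: "nat \<Rightarrow> 'a \<Rightarrow> real"
  assumes [measurable]: "\<And>k. v k \<in> borel_measurable M"
    and cau: "\<And>e. 0 < e \<Longrightarrow> \<exists>k0. \<forall>k\<ge>k0. \<forall>l\<ge>k0. (\<integral>\<^sup>+x. ennreal \<bar>v k x - v l x\<bar> \<partial>M) \<le> ennreal e"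
  shows "\<exists>r::nat \<Rightarrow> nat. strict_mono r \<and> (AE x in M. convergent (\<lambda>k. v (r k) x))"
proof -
  have "\<forall>i. \<exists>k0. \<forall>k\<ge>k0. \<forall>l\<ge>k0. (\<integral>\<^sup>+x. ennreal \<bar>v k x - v l x\<bar> \<partial>M) \<le> ennreal ((1/2)^i)"
    using cau by simp
  then obtain \<phi> where \<phi>: "\<And>i k l. \<phi> i \<le> k \<Longrightarrow> \<phi> i \<le> l \<Longrightarrow> (\<integral>\<^sup>+x. ennreal \<bar>v k x - v l x\<bar> \<partial>M) \<le> ennreal ((1/2)^i)"
    by metis
  \<comment> \<open>A strictly increasing sequence that dominates \<open>\<phi>\<close>.\<close>
  define r where "r i = (\<Sum>j\<le>i. Suc (\<phi> j))" for i
  have r: "strict_mono r" by (rule strict_monoI_Suc) (simp add: r_def)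
  have r_ge: "\<phi> i \<le> r i" for i unfolding r_def by (cases i) auto
  have "(\<integral>\<^sup>+x. (\<Sum>i. ennreal \<bar>v (r (Suc i)) x - v (r i) x\<bar>) \<partial>M)
      = (\<Sum>i. \<integral>\<^sup>+x. ennreal \<bar>v (r (Suc i)) x - v (r i) x\<bar> \<partial>M)"
    by (rule nn_integral_suminf) measurable
  also have "\<dots> \<le> (\<Sum>i. ennreal ((1/2)^i))"
  proof (intro suminf_le \<phi>)
    show "\<phi> i \<le> r (Suc i)" "\<phi> i \<le> r i" for i
      using r_ge[of i] strict_mono_less_eq[OF r, of i "Suc i"] by auto
  qed auto
  also have "\<dots> = ennreal (\<Sum>i. (1/2)^i)" by (rule suminf_ennreal2) (auto intro: summable_geometric)
  finally have fin: "(\<integral>\<^sup>+x. (\<Sum>i. ennreal \<bar>v (r (Suc i)) x - v (r i) x\<bar>) \<partial>M) \<noteq> \<infinity>"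
    by (auto simp: top_unique)
  have "AE x in M. (\<Sum>i. ennreal \<bar>v (r (Suc i)) x - v (r i) x\<bar>) \<noteq> \<infinity>"
    by (rule nn_integral_PInf_AE[OF _ fin]) measurable
  then have "AE x in M. convergent (\<lambda>k. v (r k) x)"
  proof eventually_elim
    fix x assume "(\<Sum>i. ennreal \<bar>v (r (Suc i)) x - v (r i) x\<bar>) \<noteq> \<infinity>"
    then have "summable (\<lambda>i. \<bar>v (r (Suc i)) x - v (r i) x\<bar>)"
      by (intro summable_suminf_not_top) auto
    then have "summable (\<lambda>i. v (r (Suc i)) x - v (r i) x)" by (rule summable_rabs_cancel)
    then have "convergent (\<lambda>k. \<Sum>i<k. v (r (Suc i)) x - v (r i) x)"
      by (simp add: summable_iff_convergent)
    then have "convergent (\<lambda>k. v (r 0) x + (v (r k) x - v (r 0) x))"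
      using sum_lessThan_telescope[of "\<lambda>i. v (r i) x"]
      by (intro convergent_add convergent_const) simp
    then show "convergent (\<lambda>k. v (r k) x)" by simp
  qed
  then show ?thesis using r by blast
qed

text \<open>
  The elementary inequality \<open>d \<le> \<eta> + \<eta> powr (1 - p) * d powr p\<close>, for \<open>d \<ge> 0\<close>, takes the place of
  Jensen's inequality: the free parameter \<open>\<eta>\<close> is chosen before \<open>\<delta>\<close>. The quotient is the average of \<open>u\<close>
  over the ball.
\<close>
lemma ball_average_difference_le:
  fixes u :: "real ^ 'n \<Rightarrow> real" and x c :: "real ^ 'n" and s p \<delta> \<eta> :: real
  defines "\<omega> \<equiv> unit_ball_vol (real CARD('n))"
  assumes s: "0 < s" and p: "1 < p" and \<delta>: "0 < \<delta>" and \<eta>: "0 < \<eta>" and u: "integrable lebesgue u"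
    and x: "x \<in> ball c \<delta>"
  shows "ennreal \<bar>u x - (LINT y:ball c \<delta>|lebesgue. u y) / (\<omega> * \<delta> powr real CARD('n))\<bar>
    \<le> ennreal \<eta> + ennreal (\<eta> powr (1 - p) * 2 powr (real CARD('n) + s * p) / \<omega> * \<delta> powr (s * p)) * gag_density s p u x"
proof -
  define N where "N = real CARD('n)"
  have N: "0 < N" by (simp add: N_def)
  have \<omega>: "0 < \<omega>" by (simp add: \<omega>_def)
  define B where "B = ball c \<delta>"
  have [measurable]: "B \<in> sets lebesgue" by (simp add: B_def)
  have [measurable]: "u \<in> borel_measurable lebesgue" using u by auto
  define \<beta> where "\<beta> = \<omega> * \<delta> powr N"
  have \<beta>: "0 < \<beta>" using \<omega> \<delta> by (simp add: \<beta>_def)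
  have eB: "emeasure lebesgue B = ennreal \<beta>"
    using emeasure_lebesgue_ball[of \<delta> c] \<delta> unfolding B_def \<beta>_def \<omega>_def N_def by linarith
  then have mB: "measure lebesgue B = \<beta>" using \<beta> by (simp add: measure_def)
  have iu: "integrable lebesgue (\<lambda>y. indicator B y * u y)"
    using integrable_mult_indicator[OF _ u, of B] by simp
  have ic: "integrable lebesgue (\<lambda>y. indicator B y * u x)"
    using eB by simp
  have "u x - (LINT y:B|lebesgue. u y) / \<beta> = (1 / \<beta>) * (LINT y|lebesgue. indicator B y * (u x - u y))"
  proof -
    have "(LINT y|lebesgue. indicator B y * (u x - u y)) = \<beta> * u x - (LINT y:B|lebesgue. u y)"
      using iu ic mB by (simp add: algebra_simps set_lebesgue_integral_def)
    then show ?thesis using \<beta> by (simp add: field_simps)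
  qed
  then have "ennreal \<bar>u x - (LINT y:B|lebesgue. u y) / \<beta>\<bar>
    = ennreal (1 / \<beta>) * ennreal \<bar>LINT y|lebesgue. indicator B y * (u x - u y)\<bar>"
    using \<beta> by (simp add: abs_mult flip: ennreal_mult'')
  also have "\<dots> \<le> ennreal (1 / \<beta>) * (\<integral>\<^sup>+y. ennreal \<bar>indicator B y * (u x - u y)\<bar> \<partial>lebesgue)"
    using integral_norm_bound_ennreal[of lebesgue "\<lambda>y. indicator B y * (u x - u y)"] iu ic
    by (intro mult_left_mono) (auto simp: algebra_simps)
  also have "\<dots> \<le> ennreal (1 / \<beta>) * (\<integral>\<^sup>+y. ennreal \<eta> * indicator B y
      + ennreal (\<eta> powr (1 - p) * (2 * \<delta>) powr (N + s * p)) * ennreal (gagliardo_quot s p u (x, y)) \<partial>lebesgue)"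
  proof (intro mult_left_mono nn_integral_mono)
    fix y
    show "ennreal \<bar>indicator B y * (u x - u y)\<bar> \<le> ennreal \<eta> * indicator B y
      + ennreal (\<eta> powr (1 - p) * (2 * \<delta>) powr (N + s * p)) * ennreal (gagliardo_quot s p u (x, y))"
    proof (cases "y \<in> B \<and> y \<noteq> x")
      case True
      define d where "d = \<bar>u x - u y\<bar>"
      have "norm (x - y) \<le> 2 * \<delta>"
        using x True dist_triangle[of x y c] by (auto simp: B_def dist_norm norm_minus_commute)
      then have np: "norm (x - y) powr (N + s * p) \<le> (2 * \<delta>) powr (N + s * p)"
        using s p N by (intro powr_mono2) auto
      have "d \<le> \<eta> + \<eta> powr (1 - p) * d powr p"
      proof (cases "d \<le> \<eta>")
        case False
        then have "d = d powr (1 - p) * d powr p" using \<eta> by (simp flip: powr_add)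
        also have "\<dots> \<le> \<eta> powr (1 - p) * d powr p"
          using False \<eta> p by (intro mult_right_mono powr_mono2') auto
        finally show ?thesis using \<eta> by simp
      qed (simp add: add_increasing2)
      also have "d powr p = norm (x - y) powr (N + s * p) * gagliardo_quot s p u (x, y)"
        using True by (simp add: d_def gagliardo_quot_def N_def)
      also have "\<dots> \<le> (2 * \<delta>) powr (N + s * p) * gagliardo_quot s p u (x, y)"
        using np by (rule mult_right_mono) simp
      finally have "d \<le> \<eta> + \<eta> powr (1 - p) * (2 * \<delta>) powr (N + s * p) * gagliardo_quot s p u (x, y)"
        using \<eta> by (simp add: mult.assoc mult_left_mono)
      then show ?thesis
        using True \<eta> by (simp add: d_def flip: ennreal_mult'' ennreal_plus)
    qed auto
  qed simp
  also have "\<dots> = ennreal (1 / \<beta>) * (ennreal \<eta> * ennreal \<beta>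
      + ennreal (\<eta> powr (1 - p) * (2 * \<delta>) powr (N + s * p)) * gag_density s p u x)"
    by (simp add: nn_integral_add nn_integral_cmult nn_integral_cmult_indicator eB gag_density_def)
  also have "\<dots> = ennreal (1 / \<beta> * (\<eta> * \<beta>))
      + ennreal (1 / \<beta> * (\<eta> powr (1 - p) * (2 * \<delta>) powr (N + s * p))) * gag_density s p u x"
  proof -
    have "ennreal b * (ennreal c * ennreal d + ennreal e * X) = ennreal (b * (c * d)) + ennreal (b * e) * X"
      if "0 \<le> b" "0 \<le> c" "0 \<le> d" "0 \<le> e" for b c d e X
      using that by (simp add: distrib_left ennreal_mult mult.assoc)
    then show ?thesis using \<beta> \<eta> by simp
  qed
  also have "1 / \<beta> * (\<eta> * \<beta>) = \<eta>" using \<beta> by simp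
  also have "1 / \<beta> * (\<eta> powr (1 - p) * (2 * \<delta>) powr (N + s * p))
     = \<eta> powr (1 - p) * 2 powr (N + s * p) / \<omega> * \<delta> powr (s * p)"
    using \<delta> \<omega> by (simp add: \<beta>_def powr_mult powr_add)
  finally show ?thesis by (simp add: B_def \<beta>_def N_def)
qed

lemma gag_compactness:
  fixes u :: "nat \<Rightarrow> real ^ 'n \<Rightarrow> real" and s p R :: real and \<Omega> :: "(real ^ 'n) set"
  assumes s: "0 < s" and p: "1 < p" and \<Omega>: "bounded \<Omega>" "\<Omega> \<in> sets lebesgue"
    and um [measurable]: "\<And>k. u k \<in> borel_measurable lebesgue"
    and u0: "\<And>k x. x \<notin> \<Omega> \<Longrightarrow> u k x = 0"
    and u1: "\<And>k. (\<integral>\<^sup>+x. ennreal (\<bar>u k x\<bar> powr p) \<partial>lebesgue) \<le> 1"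
    and uE: "\<And>k. gag_energy s p (u k) \<le> ennreal R" and R: "0 \<le> R"
  shows "\<exists>(r :: nat \<Rightarrow> nat) v. strict_mono r \<and> v \<in> borel_measurable lebesgue \<and> (\<forall>x. x \<notin> \<Omega> \<longrightarrow> v x = 0) \<and>
    (AE x in lebesgue. (\<lambda>k. u (r k) x) \<longlonglongrightarrow> v x)"
proof -
  define N where "N = real CARD('n)"
  have N: "0 < N" by (simp add: N_def)
  define \<omega> where "\<omega> = unit_ball_vol N"
  have \<omega>: "0 < \<omega>" using N by (simp add: \<omega>_def)
  note [measurable] = \<Omega>(2)
  have lm: "\<Omega> \<in> lmeasurable" using \<Omega> by (rule bounded_set_imp_lmeasurable)
  define w where "w = measure lebesgue \<Omega>"
  have w: "0 \<le> w" "emeasure lebesgue \<Omega> = ennreal w"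
    using lm by (auto simp: w_def emeasure_eq_measure2)
  have ip: "integrable lebesgue (\<lambda>x. \<bar>u k x\<bar> powr p)" for k
    using u1[of k] by (auto simp: integrable_iff_bounded intro: le_less_trans)
  have i\<Omega>: "integrable lebesgue (indicator \<Omega> :: _ \<Rightarrow> real)" using w by simp
  have le_p: "\<bar>u k x\<bar> \<le> indicator \<Omega> x + \<bar>u k x\<bar> powr p" for k x
  proof (cases "x \<in> \<Omega>")
    case True
    then show ?thesis using powr_mono[of 1 p "\<bar>u k x\<bar>"] p
      by (cases "\<bar>u k x\<bar> \<le> 1") (auto simp: add_increasing2)
  qed (simp add: u0)
  have iu: "integrable lebesgue (u k)" for k
    by (rule Bochner_Integration.integrable_bound[OF Bochner_Integration.integrable_add[OF i\<Omega> ip[of k]]])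
      (use le_p in \<open>auto intro!: AE_I2 order_trans[OF le_p]\<close>)
  have L1: "(LINT x|lebesgue. \<bar>u k x\<bar>) \<le> w + 1" for k
  proof -
    have "ennreal (LINT x|lebesgue. \<bar>u k x\<bar> powr p) \<le> ennreal 1"
      using u1[of k] ip[of k] by (simp add: nn_integral_eq_integral)
    then have "(LINT x|lebesgue. \<bar>u k x\<bar> powr p) \<le> 1" by (subst (asm) ennreal_le_iff) auto
    moreover have "(LINT x|lebesgue. \<bar>u k x\<bar>) \<le> (LINT x|lebesgue. indicator \<Omega> x + \<bar>u k x\<bar> powr p)"
      using iu ip i\<Omega> le_p by (intro integral_mono) auto
    ultimately show ?thesis using ip[of k] i\<Omega> by (simp add: w_def)
  qed
  \<comment> \<open>The integral of \<open>u k\<close> over the ball with centre \<open>fst z\<close> and radius \<open>1 / (snd z + 1)\<close>.\<close>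
  define f where "f k z = (LINT y:ball (fst z) (1 / real (Suc (snd z)))|lebesgue. u k y)"
    for k :: nat and z :: "(real ^ 'n) \<times> nat"
  have fb: "norm (f k z) \<le> w + 1" for k z
  proof -
    have "norm (f k z) \<le> (LINT y|lebesgue. \<bar>indicator (ball (fst z) (1 / real (Suc (snd z)))) y * u k y\<bar>)"
      unfolding f_def set_lebesgue_integral_def by (simp del: of_nat_Suc)
    also have "\<dots> \<le> (LINT y|lebesgue. \<bar>u k y\<bar>)"
      using iu[of k] integrable_mult_indicator[OF _ iu[of k], of "ball (fst z) (1 / real (Suc (snd z)))"]
      by (intro integral_mono) (auto simp: indicator_def)
    finally show ?thesis using L1[of k] by simp
  qed
  have "\<forall>j. \<exists>F. finite F \<and> \<Omega> \<subseteq> (\<Union>c\<in>F. ball c (1 / real (Suc j)))"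
  proof
    fix j :: nat
    have "compact (closure \<Omega>)" using \<Omega>(1) by simp
    then obtain F where "finite F" "closure \<Omega> \<subseteq> (\<Union>c\<in>F. ball c (1 / real (Suc j)))"
      unfolding compact_eq_totally_bounded by (meson of_nat_0_less_iff zero_less_Suc zero_less_divide_1_iff)
    then show "\<exists>F. finite F \<and> \<Omega> \<subseteq> (\<Union>c\<in>F. ball c (1 / real (Suc j)))"
      using closure_subset by blast
  qed
  then obtain F where F: "\<And>j. finite (F j)" "\<And>j. \<Omega> \<subseteq> (\<Union>c\<in>F j. ball c (1 / real (Suc j)))"
    by metis
  have cS: "countable (\<Union>j. (\<lambda>c. (c, j)) ` F j)"
    using F(1) by (intro countable_UN countable_image) (auto intro: countable_finite)
  obtain r1 :: "nat \<Rightarrow> nat" where r1: "strict_mono r1" and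
    "\<And>z. z \<in> (\<Union>j. (\<lambda>c. (c, j)) ` F j) \<Longrightarrow> \<exists>l. (\<lambda>k. f (r1 k) z) \<longlonglongrightarrow> l"
    using function_convergent_subsequence[OF cS, of f "w + 1"] fb by blast
  then have "\<forall>j c. c \<in> F j \<longrightarrow> (\<exists>l. (\<lambda>k. f (r1 k) (c, j)) \<longlonglongrightarrow> l)" by blast
  then obtain L where L: "\<And>j c. c \<in> F j \<Longrightarrow> (\<lambda>k. f (r1 k) (c, j)) \<longlonglongrightarrow> L j c" by metis
  define v where "v k = u (r1 k)" for k
  have vm [measurable]: "v k \<in> borel_measurable lebesgue" for k by (simp add: v_def)
  have cau: "\<exists>k0. \<forall>k\<ge>k0. \<forall>l\<ge>k0. (\<integral>\<^sup>+x. ennreal \<bar>v k x - v l x\<bar> \<partial>lebesgue) \<le> ennreal e"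
    if e: "0 < e" for e :: real
  proof -
    define \<eta> where "\<eta> = e / (6 * (w + 1))"
    have \<eta>: "0 < \<eta>" using e w by (simp add: \<eta>_def)
    define \<kappa> where "\<kappa> j = \<eta> powr (1 - p) * 2 powr (N + s * p) / \<omega> * (1 / real (Suc j)) powr (s * p)" for j
    have \<kappa>0: "0 \<le> \<kappa> j" for j using \<omega> by (simp add: \<kappa>_def)
    have "(\<lambda>j. (1 / real (Suc j)) powr (s * p)) \<longlonglongrightarrow> 0 powr (s * p)"
      using LIMSEQ_inverse_real_of_nat s p
      by (intro tendsto_powr') (auto simp: inverse_eq_divide)
    then have "(\<lambda>j. 2 * \<kappa> j * R) \<longlonglongrightarrow> 2 * (\<eta> powr (1 - p) * 2 powr (N + s * p) / \<omega> * 0) * R"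
      unfolding \<kappa>_def using s p by (intro tendsto_intros) auto
    then have "eventually (\<lambda>j. 2 * \<kappa> j * R < e / 3) sequentially"
      using e by (intro order_tendstoD(2)) auto
    then obtain j where j: "2 * \<kappa> j * R < e / 3" by (auto simp: eventually_sequentially)
    define \<delta> where "\<delta> = 1 / real (Suc j)"
    have \<delta>: "0 < \<delta>" by (simp add: \<delta>_def)
    define \<beta> where "\<beta> = \<omega> * \<delta> powr N"
    have \<beta>: "0 < \<beta>" using \<omega> \<delta> by (simp add: \<beta>_def)
    define h where "h k = (\<Sum>c\<in>F j. \<bar>f (r1 k) (c, j) - L j c\<bar> / \<beta>)" for k
    have h0: "0 \<le> h k" for k using \<beta> by (auto simp: h_def intro!: sum_nonneg)
    have "h \<longlonglongrightarrow> (\<Sum>c\<in>F j. \<bar>L j c - L j c\<bar> / \<beta>)"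
      unfolding h_def using \<beta> by (intro tendsto_intros L) auto
    then have "eventually (\<lambda>k. h k < \<eta>) sequentially"
      using \<eta> by (intro order_tendstoD(2)) auto
    then obtain k0 where k0: "\<And>k. k0 \<le> k \<Longrightarrow> h k < \<eta>" by (auto simp: eventually_sequentially)
    \<comment> \<open>Every late \<open>v k\<close> is close to one and the same constant on each ball of the cover, up to the density of the energy.\<close>
    have near: "ennreal \<bar>v k x - L j c / \<beta>\<bar> \<le> ennreal (2 * \<eta>) + ennreal (\<kappa> j) * gag_density s p (v k) x"
      if x: "x \<in> ball c \<delta>" "c \<in> F j" and k: "k0 \<le> k" for k x c
    proof -
      have "\<bar>f (r1 k) (c, j) - L j c\<bar> / \<beta> \<le> h k"
        unfolding h_def using F(1) \<beta> x by (intro member_le_sum) auto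
      then have a: "\<bar>f (r1 k) (c, j) / \<beta> - L j c / \<beta>\<bar> \<le> \<eta>"
        using k0[OF k] \<beta> by (simp flip: diff_divide_distrib)
      have b: "ennreal \<bar>v k x - f (r1 k) (c, j) / \<beta>\<bar> \<le> ennreal \<eta> + ennreal (\<kappa> j) * gag_density s p (v k) x"
        using ball_average_difference_le[OF s p \<delta> \<eta> iu[of "r1 k"] x(1)]
        by (simp add: v_def f_def \<beta>_def \<kappa>_def \<omega>_def N_def \<delta>_def)
      have "ennreal \<bar>v k x - L j c / \<beta>\<bar> \<le> ennreal (\<bar>v k x - f (r1 k) (c, j) / \<beta>\<bar> + \<eta>)"
        using a by (intro ennreal_leI) linarith
      also have "\<dots> \<le> ennreal \<eta> + ennreal (\<kappa> j) * gag_density s p (v k) x + ennreal \<eta>"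
        using b \<eta> by (simp add: add_right_mono)
      also have "\<dots> = (ennreal \<eta> + ennreal \<eta>) + ennreal (\<kappa> j) * gag_density s p (v k) x"
        by (simp add: ac_simps)
      also have "ennreal \<eta> + ennreal \<eta> = ennreal (2 * \<eta>)" using \<eta> by (simp flip: ennreal_plus)
      finally show ?thesis .
    qed
    have "(\<integral>\<^sup>+x. ennreal \<bar>v k x - v l x\<bar> \<partial>lebesgue) \<le> ennreal e" if k: "k0 \<le> k" and l: "k0 \<le> l" for k l
    proof -
      have "(\<integral>\<^sup>+x. ennreal \<bar>v k x - v l x\<bar> \<partial>lebesgue) \<le>
        (\<integral>\<^sup>+x. ennreal (4 * \<eta>) * indicator \<Omega> x + ennreal (\<kappa> j) * (gag_density s p (v k) x + gag_density s p (v l) x) \<partial>lebesgue)"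
      proof (rule nn_integral_mono)
        fix x
        show "ennreal \<bar>v k x - v l x\<bar> \<le> ennreal (4 * \<eta>) * indicator \<Omega> x
          + ennreal (\<kappa> j) * (gag_density s p (v k) x + gag_density s p (v l) x)"
        proof (cases "x \<in> \<Omega>")
          case True
          then obtain c where c: "c \<in> F j" "x \<in> ball c \<delta>" using F(2)[of j] by (auto simp: \<delta>_def)
          have "ennreal \<bar>v k x - v l x\<bar> \<le> ennreal (\<bar>v k x - L j c / \<beta>\<bar> + \<bar>v l x - L j c / \<beta>\<bar>)"
            by (intro ennreal_leI) linarith
          also have "\<dots> = ennreal \<bar>v k x - L j c / \<beta>\<bar> + ennreal \<bar>v l x - L j c / \<beta>\<bar>" by simp
          also have "\<dots> \<le> (ennreal (2 * \<eta>) + ennreal (\<kappa> j) * gag_density s p (v k) x)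
            + (ennreal (2 * \<eta>) + ennreal (\<kappa> j) * gag_density s p (v l) x)"
            using c k l by (intro add_mono near)
          also have "\<dots> = (ennreal (2 * \<eta>) + ennreal (2 * \<eta>))
            + ennreal (\<kappa> j) * (gag_density s p (v k) x + gag_density s p (v l) x)"
            by (simp add: distrib_left ac_simps)
          also have "ennreal (2 * \<eta>) + ennreal (2 * \<eta>) = ennreal (4 * \<eta>)" using \<eta> by (simp flip: ennreal_plus)
          finally show ?thesis using True by simp
        qed (simp add: v_def u0)
      qed
      also have "\<dots> = ennreal (4 * \<eta>) * ennreal w + ennreal (\<kappa> j) * (gag_energy s p (v k) + gag_energy s p (v l))"
        by (simp add: nn_integral_add nn_integral_cmult nn_integral_cmult_indicator w gag_energy_def)
      also have "\<dots> \<le> ennreal (4 * \<eta>) * ennreal w + ennreal (\<kappa> j) * (ennreal R + ennreal R)"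
        unfolding v_def by (intro add_mono mult_left_mono order_refl uE) auto
      also have "\<dots> = ennreal (4 * \<eta> * w + 2 * \<kappa> j * R)"
        using \<eta> w \<kappa>0[of j] R by (simp add: algebra_simps flip: ennreal_mult'' ennreal_plus)
      also have "\<dots> \<le> ennreal e"
      proof (rule ennreal_leI)
        have "4 * \<eta> * w \<le> 4 * \<eta> * (w + 1)" using \<eta> by (intro mult_left_mono) auto
        also have "\<eta> * (w + 1) = e / 6" using w unfolding \<eta>_def by (simp add: divide_simps)
        then have "4 * \<eta> * (w + 1) = e * (2 / 3)" by simp
        finally show "4 * \<eta> * w + 2 * \<kappa> j * R \<le> e" using j by linarith
      qed
      finally show ?thesis .
    qed
    then show ?thesis by blast
  qed
  obtain r2 :: "nat \<Rightarrow> nat" where r2: "strict_mono r2" and conv: "AE x in lebesgue. convergent (\<lambda>k. v (r2 k) x)"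
    using L1_Cauchy_AE_subseq[of v lebesgue] cau vm by blast
  show ?thesis
  proof (intro exI conjI allI impI)
    show "strict_mono (r1 \<circ> r2)" using r1 r2 by (rule strict_mono_o)
    show "(\<lambda>x. lim (\<lambda>k. v (r2 k) x)) \<in> borel_measurable lebesgue"
      by (rule borel_measurable_lim_metric) measurable
    show "lim (\<lambda>k. v (r2 k) x) = 0" if "x \<notin> \<Omega>" for x
      using that by (simp add: v_def u0)
    show "AE x in lebesgue. (\<lambda>k. u ((r1 \<circ> r2) k) x) \<longlonglongrightarrow> lim (\<lambda>k. v (r2 k) x)"
      using conv by eventually_elim (simp add: v_def convergent_LIMSEQ_iff)
  qed
qed

section \<open>The linear structure of the function spaces\<close>

lemma gagliardo_quot_scale:
  "gagliardo_quot s p (\<lambda>x. c * u x) z = \<bar>c\<bar> powr p * gagliardo_quot s p u z"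
  by (cases z) (simp add: gagliardo_quot_def powr_mult abs_mult flip: right_diff_distrib)

lemma gag_energy_scale:
  fixes u :: "real ^ 'n \<Rightarrow> real"
  assumes [measurable]: "u \<in> borel_measurable lebesgue"
  shows "gag_energy s p (\<lambda>x. c * u x) = ennreal (\<bar>c\<bar> powr p) * gag_energy s p u"
  by (simp add: gag_energy_eq_pair gagliardo_quot_scale ennreal_mult nn_integral_cmult)

lemma Wsp_scale:
  fixes u :: "real ^ 'n \<Rightarrow> real"
  assumes "u \<in> Wsp s p UNIV"
  shows "(\<lambda>x. c * u x) \<in> Wsp s p UNIV"
proof -
  have [measurable]: "u \<in> borel_measurable lebesgue" using assms by (simp add: Wsp_UNIV_iff)
  show ?thesis
    using assms unfolding Wsp_UNIV_iff
    by (auto simp: gag_energy_scale abs_mult powr_mult ennreal_mult nn_integral_cmult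
        ennreal_mult_less_top)
qed

lemma Wsp_add:
  fixes u v :: "real ^ 'n \<Rightarrow> real"
  assumes p: "0 \<le> p" and u: "u \<in> Wsp s p UNIV" and v: "v \<in> Wsp s p UNIV"
  shows "(\<lambda>x. u x + v x) \<in> Wsp s p UNIV"
proof -
  have [measurable]: "u \<in> borel_measurable lebesgue" "v \<in> borel_measurable lebesgue"
    using u v by (auto simp: Wsp_UNIV_iff)
  have 1: "integrable lebesgue (\<lambda>x. 1 * \<bar>u x + v x\<bar> powr p)"
    using integrable_Wsp_powr[OF u] integrable_Wsp_powr[OF v]
    by (intro integrable_weighted_powr_add p) auto
  have 2: "integrable (lebesgue \<Otimes>\<^sub>M lebesgue) (gagliardo_quot s p (\<lambda>x. u x + v x))"
  proof (rule Bochner_Integration.integrable_bound)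
    show "integrable (lebesgue \<Otimes>\<^sub>M lebesgue) (\<lambda>z. 2 powr p * (gagliardo_quot s p u z + gagliardo_quot s p v z))"
      using integrable_gagliardo_quot[OF u] integrable_gagliardo_quot[OF v] by simp
    show "AE z in lebesgue \<Otimes>\<^sub>M lebesgue. norm (gagliardo_quot s p (\<lambda>x. u x + v x) z)
      \<le> norm (2 powr p * (gagliardo_quot s p u z + gagliardo_quot s p v z))"
    proof (rule AE_I2)
      fix z :: "(real ^ 'n) \<times> (real ^ 'n)"
      obtain x y where z: "z = (x, y)" by (cases z)
      have "\<bar>(u x - u y) + (v x - v y)\<bar> powr p / norm (x - y) powr (real CARD('n) + s * p)
        \<le> 2 powr p * (\<bar>u x - u y\<bar> powr p + \<bar>v x - v y\<bar> powr p) / norm (x - y) powr (real CARD('n) + s * p)"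
        by (intro divide_right_mono abs_add_powr_le p) auto
      moreover have "(u x - u y) + (v x - v y) = (u x + v x) - (u y + v y)" by simp
      ultimately show "norm (gagliardo_quot s p (\<lambda>x. u x + v x) z)
        \<le> norm (2 powr p * (gagliardo_quot s p u z + gagliardo_quot s p v z))"
        by (simp add: z gagliardo_quot_def flip: add_divide_distrib)
    qed
  qed measurable
  show ?thesis using 1 2 by (simp add: Wsp_def Lp_def lebesgue_on_UNIV_eq)
qed

section \<open>A cone has finite energy\<close>

lemma nn_integral_lebesgue_translate:
  fixes K :: "'a::euclidean_space \<Rightarrow> ennreal"
  assumes [measurable]: "K \<in> borel_measurable borel"
  shows "(\<integral>\<^sup>+y. K (y - x) \<partial>lebesgue) = (\<integral>\<^sup>+y. K y \<partial>lebesgue)"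
proof -
  have "(\<integral>\<^sup>+y. K y \<partial>lborel) = (\<integral>\<^sup>+y. K y \<partial>distr lborel borel ((+) (- x)))"
    by (simp add: lborel_distr_plus)
  also have "\<dots> = (\<integral>\<^sup>+y. K (- x + y) \<partial>lborel)"
    by (rule nn_integral_distr)
      (use assms in \<open>auto intro!: borel_measurable_continuous_onI continuous_intros\<close>)
  finally show ?thesis by (simp add: nn_integral_completion)
qed

text \<open>
  Near 0 the integrand is \<open>norm y powr (p - s * p - N)\<close>, integrable since \<open>s < 1\<close>; at infinity it is
  \<open>norm y powr (- N - s * p)\<close>, integrable since \<open>s > 0\<close>. It is compared with a sum of constants times
  indicators of balls of dyadic radii, which leads to two geometric series.
\<close>
lemma gagliardo_kernel_finite:
  fixes s p :: real
  assumes s: "0 < s" "s < 1" and p: "0 < p"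
  shows "(\<integral>\<^sup>+y. ennreal (min 1 (norm (y :: real ^ 'n)) powr p / norm y powr (real CARD('n) + s * p)) \<partial>lebesgue) < \<infinity>"
proof -
  define N where "N = real CARD('n)"
  have N: "0 < N" by (simp add: N_def)
  define \<omega> where "\<omega> = unit_ball_vol N"
  have \<omega>: "0 < \<omega>" using N by (simp add: \<omega>_def)
  define \<sigma> where "\<sigma> = N + s * p"
  \<comment> \<open>For \<open>\<sigma> < p\<close> the integrand is at most 1 and increasing near 0; hence the maximum.\<close>
  define a where "a = max 0 (\<sigma> - p)"
  have a: "0 \<le> a" "\<sigma> - p \<le> a" by (auto simp: a_def)
  have sp: "s * p < p" "0 < s * p" using s p by auto
  have aN: "a < N" using N sp by (auto simp: a_def \<sigma>_def)
  define h :: "real ^ 'n \<Rightarrow> real" where "h y = min 1 (norm y) powr p / norm y powr \<sigma>" for y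
  define c where "c k = ((1/2)^Suc k) powr (- a)" for k
  define d where "d k = (2 ^ k) powr (- \<sigma>)" for k :: nat
  let ?I = "\<lambda>r. indicator (ball (0 :: real ^ 'n) r) :: real ^ 'n \<Rightarrow> ennreal"
  have [measurable]: "ball (0 :: real ^ 'n) r \<in> sets lebesgue" for r by simp
  have single: "f k \<le> (\<Sum>i. f i)" for f :: "nat \<Rightarrow> ennreal" and k
    using sum_le_suminf[of f "{k}"] by simp
  have pw: "ennreal (h y) \<le> (\<Sum>k. ennreal (c k) * ?I (2 * (1/2)^k) y) + (\<Sum>k. ennreal (d k) * ?I (2 * 2^k) y)" for y
  proof -
    consider "y = 0" | "0 < norm y" "norm y \<le> 1" | "1 < norm y" by force
    then show ?thesis
    proof cases
      case 1 then show ?thesis by (simp add: h_def)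
    next
      case 2
      have "\<exists>n. (1/2::real)^n < norm y" using 2 by (intro real_arch_pow_inv) auto
      then obtain n where n: "(1/2::real)^n < norm y" "\<And>i. i < n \<Longrightarrow> \<not> (1/2)^i < norm y"
        using exists_least_iff[of "\<lambda>n. (1/2::real)^n < norm y"] by blast
      have "n \<noteq> 0" using n(1) 2 by (intro notI) simp
      then obtain k where k: "n = Suc k" using not0_implies_Suc by blast
      have le: "norm y \<le> (1/2)^k" using n(2)[of k] k by simp
      moreover have "(0::real) < (1/2)^k" by simp
      ultimately have "norm y < 2 * (1/2)^k" by linarith
      then have ball: "y \<in> ball 0 (2 * (1/2)^k)" by simp
      have "h y = norm y powr (- (\<sigma> - p))"
        using 2 by (simp add: h_def powr_diff powr_minus divide_simps)
      also have "\<dots> \<le> norm y powr (- a)"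
        using 2 a by (intro powr_mono') auto
      also have "\<dots> \<le> c k" unfolding c_def using n(1) k a by (intro powr_mono2') auto
      finally have "ennreal (h y) \<le> ennreal (c k) * ?I (2 * (1/2)^k) y"
        using ball by (simp add: ennreal_leI)
      also have "\<dots> \<le> (\<Sum>k. ennreal (c k) * ?I (2 * (1/2)^k) y)" by (rule single)
      finally show ?thesis by (simp add: add_increasing2)
    next
      case 3
      have "\<exists>n. norm y < (2::real)^n" by (intro real_arch_pow) auto
      then obtain n where n: "norm y < (2::real)^n" "\<And>i. i < n \<Longrightarrow> \<not> norm y < 2^i"
        using exists_least_iff[of "\<lambda>n. norm y < (2::real)^n"] by blast
      have "n \<noteq> 0" using n(1) 3 by (intro notI) simp
      then obtain k where k: "n = Suc k" using not0_implies_Suc by blast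
      have ball: "y \<in> ball 0 (2 * 2^k)" using n(1) k by simp
      have "h y = norm y powr (- \<sigma>)"
        using 3 by (simp add: h_def powr_minus divide_simps)
      also have "\<dots> \<le> d k" unfolding d_def using n(2)[of k] k N sp by (intro powr_mono2') (auto simp: \<sigma>_def)
      finally have "ennreal (h y) \<le> ennreal (d k) * ?I (2 * 2^k) y"
        using ball by (simp add: ennreal_leI)
      also have "\<dots> \<le> (\<Sum>k. ennreal (d k) * ?I (2 * 2^k) y)" by (rule single)
      finally show ?thesis by (simp add: add_increasing)
    qed
  qed
  have ball_int: "(\<integral>\<^sup>+y. ennreal b * ?I r y \<partial>lebesgue) = ennreal (b * (\<omega> * r powr N))" if "0 \<le> r" "0 \<le> b" for r b
    using emeasure_lebesgue_ball[OF that(1), of "0 :: real ^ 'n"] that \<omega>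
    by (simp add: nn_integral_cmult_indicator \<omega>_def N_def flip: ennreal_mult'')
  have pow: "(x ^ k) powr e = (x powr e) ^ k" if "0 < x" for x e :: real and k :: nat
    using that by (induction k) (simp_all add: powr_mult)
  have "(\<integral>\<^sup>+y. (\<Sum>k. ennreal (c k) * ?I (2 * (1/2)^k) y) \<partial>lebesgue)
      = (\<Sum>k. \<integral>\<^sup>+y. ennreal (c k) * ?I (2 * (1/2)^k) y \<partial>lebesgue)"
    by (rule nn_integral_suminf) measurable
  also have "\<dots> = (\<Sum>k. ennreal (c k * (\<omega> * (2 * (1/2)^k) powr N)))"
    by (intro suminf_cong ball_int) (simp_all add: c_def)
  also have "\<dots> = (\<Sum>k. ennreal (((1/2) powr (- a) * \<omega> * 2 powr N) * ((1/2) powr (N - a))^k))"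
  proof (intro suminf_cong arg_cong[where f = ennreal])
    fix k :: nat
    have "c k = (1/2) powr (- a) * ((1/2) powr (- a)) ^ k" unfolding c_def by (subst pow) auto
    moreover have "(2 * (1/2)^k) powr N = 2 powr N * ((1/2) powr N) ^ k"
      by (simp add: powr_mult pow del: power_one_over)
    moreover have "((1/2::real) powr (N - a)) ^ k = ((1/2) powr (- a)) ^ k * ((1/2) powr N) ^ k"
      by (simp flip: power_mult_distrib powr_add)
    ultimately show "c k * (\<omega> * (2 * (1/2)^k) powr N) = (1/2) powr (- a) * \<omega> * 2 powr N * ((1/2) powr (N - a))^k"
      by simp
  qed
  also have "\<dots> < \<infinity>"
  proof -
    have "(1/2::real) powr (N - a) < 1"
      using powr_less_mono'[of "1/2" 0 "N - a"] aN by simp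
    then have "summable (\<lambda>k. ((1/2) powr (- a) * \<omega> * 2 powr N) * ((1/2) powr (N - a))^k)"
      by (intro summable_mult summable_geometric) simp
    then show ?thesis using \<omega> by (subst suminf_ennreal2) auto
  qed
  finally have fin1: "(\<integral>\<^sup>+y. (\<Sum>k. ennreal (c k) * ?I (2 * (1/2)^k) y) \<partial>lebesgue) < \<infinity>" .
  have "(\<integral>\<^sup>+y. (\<Sum>k. ennreal (d k) * ?I (2 * 2^k) y) \<partial>lebesgue)
      = (\<Sum>k. \<integral>\<^sup>+y. ennreal (d k) * ?I (2 * 2^k) y \<partial>lebesgue)"
    by (rule nn_integral_suminf) measurable
  also have "\<dots> = (\<Sum>k. ennreal (d k * (\<omega> * (2 * 2^k) powr N)))"
    by (intro suminf_cong ball_int) (simp_all add: d_def)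
  also have "\<dots> = (\<Sum>k. ennreal ((\<omega> * 2 powr N) * (2 powr (- (s * p)))^k))"
  proof (intro suminf_cong arg_cong[where f = ennreal])
    fix k :: nat
    have "d k = (2 powr (- \<sigma>)) ^ k" unfolding d_def by (rule pow) auto
    moreover have "(2 * 2^k :: real) powr N = 2 powr N * (2 powr N) ^ k"
      by (simp add: powr_mult pow)
    moreover have "(2 powr (- (s * p))) ^ k = (2 powr (- \<sigma>)) ^ k * (2 powr N :: real) ^ k"
      by (simp add: \<sigma>_def flip: power_mult_distrib powr_add)
    ultimately show "d k * (\<omega> * (2 * 2^k) powr N) = \<omega> * 2 powr N * (2 powr (- (s * p)))^k"
      by simp
  qed
  also have "\<dots> < \<infinity>"
  proof -
    have "(2::real) powr (- (s * p)) < 1"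
      using powr_less_mono[of "- (s * p)" 0 "2"] sp by simp
    then have "summable (\<lambda>k. (\<omega> * 2 powr N) * (2 powr (- (s * p)))^k)"
      by (intro summable_mult summable_geometric) simp
    then show ?thesis using \<omega> by (subst suminf_ennreal2) auto
  qed
  finally have fin2: "(\<integral>\<^sup>+y. (\<Sum>k. ennreal (d k) * ?I (2 * 2^k) y) \<partial>lebesgue) < \<infinity>" .
  have "(\<integral>\<^sup>+y. ennreal (h y) \<partial>lebesgue) \<le>
    (\<integral>\<^sup>+y. (\<Sum>k. ennreal (c k) * ?I (2 * (1/2)^k) y) + (\<Sum>k. ennreal (d k) * ?I (2 * 2^k) y) \<partial>lebesgue)"
    by (intro nn_integral_mono pw)
  also have "\<dots> = (\<integral>\<^sup>+y. (\<Sum>k. ennreal (c k) * ?I (2 * (1/2)^k) y) \<partial>lebesgue)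
    + (\<integral>\<^sup>+y. (\<Sum>k. ennreal (d k) * ?I (2 * 2^k) y) \<partial>lebesgue)"
    by (rule nn_integral_add) measurable
  also have "\<dots> < \<infinity>" using fin1 fin2 by simp
  finally show ?thesis by (simp add: h_def \<sigma>_def N_def)
qed

lemma cone_in_Wsp:
  fixes c :: "real ^ 'n" and s p r :: real
  assumes s: "0 < s" "s < 1" and p: "0 < p" and r: "r \<le> 1"
  shows "(\<lambda>x. max 0 (r - norm (x - c))) \<in> Wsp s p UNIV"
proof -
  define \<phi> where "\<phi> x = max 0 (r - norm (x - c))" for x
  define B where "B = ball c r"
  define K :: "real ^ 'n \<Rightarrow> ennreal" where
    "K y = ennreal (min 1 (norm y) powr p / norm y powr (real CARD('n) + s * p))" for y
  have Km [measurable]: "K \<in> borel_measurable borel" unfolding K_def by measurable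
  have Kfin: "(\<integral>\<^sup>+y. K y \<partial>lebesgue) < \<infinity>"
    unfolding K_def by (rule gagliardo_kernel_finite[OF s p])
  have [measurable]: "\<phi> \<in> borel_measurable borel" unfolding \<phi>_def by measurable
  have [measurable]: "B \<in> sets borel" unfolding B_def by measurable
  have eB: "emeasure lborel B < \<infinity>" 
    unfolding B_def by (rule emeasure_bounded_finite) simp
  have \<phi>0: "\<phi> x = 0" if "x \<notin> B" for x
    using that by (simp add: \<phi>_def B_def dist_norm norm_minus_commute)
  have \<phi>le: "0 \<le> \<phi> x" "\<phi> x \<le> 1" for x
    using r norm_ge_zero[of "x - c"] unfolding \<phi>_def by linarith+
  have lip: "\<bar>\<phi> x - \<phi> y\<bar> \<le> min 1 (norm (x - y))" for x y
  proof -
    have "\<bar>norm (x - c) - norm (y - c)\<bar> \<le> norm (x - y)"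
      using norm_triangle_ineq3[of "x - c" "y - c"] by simp
    then have "\<bar>\<phi> x - \<phi> y\<bar> \<le> norm (x - y)" unfolding \<phi>_def by linarith
    moreover have "\<bar>\<phi> x - \<phi> y\<bar> \<le> 1" using \<phi>le[of x] \<phi>le[of y] by linarith
    ultimately show ?thesis by simp
  qed
  have q: "ennreal (gagliardo_quot s p \<phi> (x, y)) \<le> indicator B x * K (x - y) + indicator B y * K (x - y)" for x y
  proof -
    have le: "ennreal (gagliardo_quot s p \<phi> (x, y)) \<le> K (x - y)"
      unfolding K_def gagliardo_quot_def using lip[of x y] p
      by (auto intro!: ennreal_leI divide_right_mono powr_mono2)
    show ?thesis
    proof (cases "x \<in> B \<or> y \<in> B")
      case True then show ?thesis using le by (auto simp: indicator_def add_increasing2)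
    next
      case False then show ?thesis using p by (simp add: \<phi>0 gagliardo_quot_def)
    qed
  qed
  have sym: "K (x - y) = K (y - x)" for x y by (simp add: K_def norm_minus_commute)
  have tr1: "(\<integral>\<^sup>+y. K (x - y) \<partial>lborel) = (\<integral>\<^sup>+y. K y \<partial>lborel)" for x
    using nn_integral_lebesgue_translate[OF Km, of x] by (simp add: sym[of x] nn_integral_completion)
  have tr2: "(\<integral>\<^sup>+x. K (x - y) \<partial>lborel) = (\<integral>\<^sup>+y. K y \<partial>lborel)" for y
    using nn_integral_lebesgue_translate[OF Km, of y] by (simp add: nn_integral_completion)
  have "gag_energy s p \<phi> = (\<integral>\<^sup>+x. \<integral>\<^sup>+y. ennreal (gagliardo_quot s p \<phi> (x, y)) \<partial>lborel \<partial>lborel)"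
    by (simp add: gag_energy_def gag_density_def nn_integral_completion)
  also have "\<dots> \<le> (\<integral>\<^sup>+x. \<integral>\<^sup>+y. indicator B x * K (x - y) + indicator B y * K (x - y) \<partial>lborel \<partial>lborel)"
    by (intro nn_integral_mono q)
  also have "\<dots> = (\<integral>\<^sup>+x. \<integral>\<^sup>+y. indicator B x * K (x - y) \<partial>lborel \<partial>lborel)
      + (\<integral>\<^sup>+x. \<integral>\<^sup>+y. indicator B y * K (x - y) \<partial>lborel \<partial>lborel)"
    by (simp add: nn_integral_add)
  also have "(\<integral>\<^sup>+x. \<integral>\<^sup>+y. indicator B y * K (x - y) \<partial>lborel \<partial>lborel)
    = (\<integral>\<^sup>+y. \<integral>\<^sup>+x. indicator B y * K (x - y) \<partial>lborel \<partial>lborel)"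
    by (rule lborel_pair.Fubini') measurable
  also have "(\<integral>\<^sup>+x. \<integral>\<^sup>+y. indicator B x * K (x - y) \<partial>lborel \<partial>lborel) = emeasure lborel B * (\<integral>\<^sup>+y. K y \<partial>lborel)"
    by (simp add: nn_integral_cmult tr1 nn_integral_multc)
  also have "(\<integral>\<^sup>+y. \<integral>\<^sup>+x. indicator B y * K (x - y) \<partial>lborel \<partial>lborel) = emeasure lborel B * (\<integral>\<^sup>+y. K y \<partial>lborel)"
    by (simp add: nn_integral_cmult tr2 nn_integral_multc)
  also have "emeasure lborel B * (\<integral>\<^sup>+y. K y \<partial>lborel) + emeasure lborel B * (\<integral>\<^sup>+y. K y \<partial>lborel) < \<infinity>"
    using eB Kfin by (simp add: ennreal_mult_less_top nn_integral_completion)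
  finally have "gag_energy s p \<phi> < \<infinity>" .
  moreover have "(\<integral>\<^sup>+x. ennreal (\<bar>\<phi> x\<bar> powr p) \<partial>lebesgue) < \<infinity>"
  proof -
    have "(\<integral>\<^sup>+x. ennreal (\<bar>\<phi> x\<bar> powr p) \<partial>lebesgue) \<le> (\<integral>\<^sup>+x. indicator B x \<partial>lebesgue)"
    proof (rule nn_integral_mono)
      fix x
      have "\<bar>\<phi> x\<bar> powr p \<le> 1 powr p" using \<phi>le[of x] p by (intro powr_mono2) auto
      then show "ennreal (\<bar>\<phi> x\<bar> powr p) \<le> indicator B x"
        using \<phi>0[of x] p by (cases "x \<in> B") (auto simp flip: ennreal_1)
    qed
    also have "\<dots> < \<infinity>" using eB by (simp add: nn_integral_completion)
    finally show ?thesis .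
  qed
  ultimately have "\<phi> \<in> Wsp s p UNIV"
    by (simp add: Wsp_UNIV_iff measurable_completion)
  then show ?thesis by (simp add: \<phi>_def[abs_def])
qed

section \<open>The energy and its first variation\<close>

lemma gag_energy_liminf:
  fixes u :: "nat \<Rightarrow> real ^ 'n \<Rightarrow> real"
  assumes p: "0 < p" and um [measurable]: "\<And>k. u k \<in> borel_measurable lebesgue"
    and lim: "AE x in lebesgue. (\<lambda>k. u k x) \<longlonglongrightarrow> v x"
  shows "gag_energy s p v \<le> liminf (\<lambda>k. gag_energy s p (u k))"
proof -
  have "gag_energy s p v \<le> (\<integral>\<^sup>+x. liminf (\<lambda>k. gag_density s p (u k) x) \<partial>lebesgue)"
    unfolding gag_energy_def
  proof (rule nn_integral_mono_AE, use lim in eventually_elim)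
    fix x assume x: "(\<lambda>k. u k x) \<longlonglongrightarrow> v x"
    have "gag_density s p v x \<le> (\<integral>\<^sup>+y. liminf (\<lambda>k. ennreal (gagliardo_quot s p (u k) (x, y))) \<partial>lebesgue)"
      unfolding gag_density_def
    proof (rule nn_integral_mono_AE, use lim in eventually_elim)
      fix y assume y: "(\<lambda>k. u k y) \<longlonglongrightarrow> v y"
      have "(\<lambda>k. \<bar>u k x - u k y\<bar> powr p) \<longlonglongrightarrow> \<bar>v x - v y\<bar> powr p"
        using x y p by (intro tendsto_powr') (auto intro!: tendsto_intros)
      then have "(\<lambda>k. gagliardo_quot s p (u k) (x, y)) \<longlonglongrightarrow> gagliardo_quot s p v (x, y)"
        unfolding gagliardo_quot_def prod.case divide_inverse by (rule tendsto_mult_right)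
      then have "(\<lambda>k. ennreal (gagliardo_quot s p (u k) (x, y))) \<longlonglongrightarrow> ennreal (gagliardo_quot s p v (x, y))"
        by (intro tendsto_ennrealI)
      then have "liminf (\<lambda>k. ennreal (gagliardo_quot s p (u k) (x, y))) = ennreal (gagliardo_quot s p v (x, y))"
        by (intro lim_imp_Liminf) auto
      then show "ennreal (gagliardo_quot s p v (x, y)) \<le> liminf (\<lambda>k. ennreal (gagliardo_quot s p (u k) (x, y)))"
        by simp
    qed
    also have "\<dots> \<le> liminf (\<lambda>k. gag_density s p (u k) x)"
      unfolding gag_density_def by (rule nn_integral_liminf) measurable
    finally show "gag_density s p v x \<le> liminf (\<lambda>k. gag_density s p (u k) x)" .
  qed
  also have "\<dots> \<le> liminf (\<lambda>k. gag_energy s p (u k))"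
    unfolding gag_energy_def by (rule nn_integral_liminf) measurable
  finally show ?thesis .
qed

text \<open>The bound of \<open>potential_energy_bound\<close> extends to all of \<open>Wsp s p UNIV\<close> by scaling.\<close>
lemma integrable_potential:
  fixes s p q :: real and \<Omega> :: "(real ^ 'n) set" and V :: "real ^ 'n \<Rightarrow> real"
  assumes s: "0 < s" and p: "0 < p" and q: "1 < q" "real CARD('n) / (s * p) < q"
    and \<Omega>: "\<Omega> \<in> sets lebesgue" and V: "V \<in> Lp q \<Omega>" and u: "u \<in> Wsp s p UNIV"
  shows "integrable (lebesgue_on \<Omega>) (\<lambda>x. V x * \<bar>u x\<bar> powr p)"
proof -
  have um [measurable]: "u \<in> borel_measurable lebesgue" and
    u1: "(\<integral>\<^sup>+x. ennreal (\<bar>u x\<bar> powr p) \<partial>lebesgue) < \<infinity>" and uE: "gag_energy s p u < \<infinity>"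
    using u by (auto simp: Wsp_UNIV_iff)
  have [measurable]: "u \<in> borel_measurable (lebesgue_on \<Omega>)" "V \<in> borel_measurable (lebesgue_on \<Omega>)"
    using V by (auto simp: Lp_def intro: measurable_restrict_space1[OF um])
  obtain A where A: "0 \<le> A" "(\<integral>\<^sup>+x. ennreal (\<bar>u x\<bar> powr p) \<partial>lebesgue) = ennreal A"
    using u1 by (cases "\<integral>\<^sup>+x. ennreal (\<bar>u x\<bar> powr p) \<partial>lebesgue") auto
  obtain E where E: "0 \<le> E" "gag_energy s p u = ennreal E"
    using uE by (cases "gag_energy s p u") auto
  define K where "K = 1 + A + E"
  have K: "1 \<le> K" using A E by (simp add: K_def)
  define c where "c = K powr (- 1 / p)"
  have "\<bar>c\<bar> powr p = K powr (- 1)" using p by (simp add: c_def powr_powr)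
  then have cp: "\<bar>c\<bar> powr p = 1 / K" using K by (simp add: powr_minus_divide)
  let ?u = "\<lambda>x. c * u x"
  have "(\<integral>\<^sup>+x. ennreal (\<bar>?u x\<bar> powr p) \<partial>lebesgue)
      = (\<integral>\<^sup>+x. ennreal (1 / K) * ennreal (\<bar>u x\<bar> powr p) \<partial>lebesgue)"
    using K by (intro nn_integral_cong) (simp add: abs_mult powr_mult cp flip: ennreal_mult'')
  also have "\<dots> = ennreal (1 / K) * ennreal A"
    unfolding A(2)[symmetric] by (rule nn_integral_cmult) measurable
  also have "\<dots> = ennreal (1 / K * A)" using K by (intro ennreal_mult'[symmetric]) simp
  also have "\<dots> \<le> ennreal 1" using K A E by (intro ennreal_leI) (simp add: K_def)
  finally have 1: "(\<integral>\<^sup>+x. ennreal (\<bar>?u x\<bar> powr p) \<partial>lebesgue) \<le> 1" by simp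
  have "gag_energy s p ?u = ennreal (1 / K * E)"
    using K E by (simp add: gag_energy_scale cp flip: ennreal_mult'')
  also have "\<dots> \<le> ennreal 1" using K A E by (intro ennreal_leI) (simp add: K_def)
  finally have 2: "gag_energy s p ?u \<le> ennreal 1" .
  obtain C where "(\<integral>\<^sup>+x. ennreal (\<bar>V x\<bar> * \<bar>?u x\<bar> powr p) \<partial>lebesgue_on \<Omega>) \<le> ennreal C"
    using potential_energy_bound(1)[OF s p q \<Omega> V] 1 2
    by (elim exE conjE) (drule spec[of _ ?u], drule spec[of _ 1], auto)
  then have "integrable (lebesgue_on \<Omega>) (\<lambda>x. V x * \<bar>?u x\<bar> powr p)"
    by (auto simp: integrable_iff_bounded abs_mult intro: le_less_trans)
  then have "integrable (lebesgue_on \<Omega>) (\<lambda>x. K * (V x * \<bar>?u x\<bar> powr p))"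
    by (rule integrable_mult_right)
  moreover have "K * (V x * \<bar>?u x\<bar> powr p) = V x * \<bar>u x\<bar> powr p" for x
    using K by (simp add: abs_mult powr_mult cp)
  ultimately show ?thesis by simp
qed

lemma energy_eq:
  fixes u :: "real ^ 'n \<Rightarrow> real"
  assumes "0 < p"
  shows "energy s p \<Omega> V u = 1 / 2 * (LINT z|(lebesgue \<Otimes>\<^sub>M lebesgue). gagliardo_quot s p u z)
    + (LINT x|lebesgue_on \<Omega>. V x * \<bar>u x\<bar> powr p)"
  using assms by (simp add: energy_def gagliardo_powr_eq)

lemma energy_scale:
  fixes u :: "real ^ 'n \<Rightarrow> real"
  assumes "0 < p"
  shows "energy s p \<Omega> V (\<lambda>x. c * u x) = \<bar>c\<bar> powr p * energy s p \<Omega> V u"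
proof -
  have V: "(\<lambda>x. V x * \<bar>c * u x\<bar> powr p) = (\<lambda>x. \<bar>c\<bar> powr p * (V x * \<bar>u x\<bar> powr p))"
    by (simp add: fun_eq_iff abs_mult powr_mult)
  have q: "gagliardo_quot s p (\<lambda>x. c * u x) = (\<lambda>z. \<bar>c\<bar> powr p * gagliardo_quot s p u z)"
    by (rule ext) (rule gagliardo_quot_scale)
  show ?thesis
    unfolding energy_eq[OF assms] V q integral_mult_right_zero by (simp add: distrib_left)
qed

lemma first_variation:
  fixes u v V :: "real ^ 'n \<Rightarrow> real" and l :: real
  assumes p: "1 < p" and u: "u \<in> Wsp s p UNIV" and v: "v \<in> Wsp s p UNIV"
    and Vm: "V \<in> borel_measurable (lebesgue_on \<Omega>)"
    and Vu: "integrable (lebesgue_on \<Omega>) (\<lambda>x. V x * \<bar>u x\<bar> powr p)"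
    and Vv: "integrable (lebesgue_on \<Omega>) (\<lambda>x. V x * \<bar>v x\<bar> powr p)"
  defines "F \<equiv> \<lambda>w. energy s p \<Omega> V w - l * (LINT x|lebesgue. \<bar>w x\<bar> powr p)"
  shows "(\<lambda>k. real (Suc k) * (F (\<lambda>x. u x + v x / real (Suc k)) - F u)) \<longlonglongrightarrow>
    p * (H_form s p u v + (LINT x|lebesgue_on \<Omega>. V x * \<bar>u x\<bar> powr (p - 2) * u x * v x)
      - l * (LINT x|lebesgue. \<bar>u x\<bar> powr (p - 2) * u x * v x))"
proof -
  have um [measurable]: "u \<in> borel_measurable lebesgue" and vm [measurable]: "v \<in> borel_measurable lebesgue"
    using u v by (auto simp: Wsp_UNIV_iff)
  have [measurable]: "u \<in> borel_measurable (lebesgue_on \<Omega>)" "v \<in> borel_measurable (lebesgue_on \<Omega>)"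
    by (auto intro: measurable_restrict_space1[OF um] measurable_restrict_space1[OF vm])
  define W :: "(real ^ 'n) \<times> (real ^ 'n) \<Rightarrow> real"
    where "W = (\<lambda>(x, y). 1 / norm (x - y) powr (real CARD('n) + s * p))"
  define A where "A = (\<lambda>(x, y). u x - u y)"
  define B where "B = (\<lambda>(x, y). v x - v y)"
  have [measurable]: "W \<in> borel_measurable (lebesgue \<Otimes>\<^sub>M lebesgue)"
    "A \<in> borel_measurable (lebesgue \<Otimes>\<^sub>M lebesgue)" "B \<in> borel_measurable (lebesgue \<Otimes>\<^sub>M lebesgue)"
    unfolding W_def A_def B_def by measurable
  have qA: "(\<lambda>z. W z * \<bar>A z\<bar> powr p) = gagliardo_quot s p u"
    by (auto simp: W_def A_def gagliardo_quot_def)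
  have qB: "(\<lambda>z. W z * \<bar>B z\<bar> powr p) = gagliardo_quot s p v"
    by (auto simp: W_def B_def gagliardo_quot_def)
  have qk: "(\<lambda>z. W z * \<bar>A z + B z / real (Suc k)\<bar> powr p) = gagliardo_quot s p (\<lambda>x. u x + v x / real (Suc k))" for k
  proof (rule ext)
    fix z :: "(real ^ 'n) \<times> (real ^ 'n)"
    obtain x y where z: "z = (x, y)" by (cases z)
    have "A z + B z / real (Suc k) = u x + v x / real (Suc k) - (u y + v y / real (Suc k))"
      by (simp add: z A_def B_def diff_divide_distrib del: of_nat_Suc)
    then show "W z * \<bar>A z + B z / real (Suc k)\<bar> powr p = gagliardo_quot s p (\<lambda>x. u x + v x / real (Suc k)) z"
      by (simp only: W_def gagliardo_quot_def z prod.case) simp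
  qed
  have H: "(LINT z|(lebesgue \<Otimes>\<^sub>M lebesgue). W z * (\<bar>A z\<bar> powr (p - 2) * A z) * B z) = 2 * H_form s p u v"
    unfolding H_form_def
    by (simp add: W_def A_def B_def case_prod_unfold)
  note D1 = weighted_powr_difference_quotient[OF p, of W "lebesgue \<Otimes>\<^sub>M lebesgue" A B, unfolded qA qB qk H]
  have D1: "(\<lambda>k. real (Suc k) * ((LINT z|(lebesgue \<Otimes>\<^sub>M lebesgue). gagliardo_quot s p (\<lambda>x. u x + v x / real (Suc k)) z)
      - (LINT z|(lebesgue \<Otimes>\<^sub>M lebesgue). gagliardo_quot s p u z))) \<longlonglongrightarrow> p * (2 * H_form s p u v)"
    by (rule D1) (use integrable_gagliardo_quot[OF u] integrable_gagliardo_quot[OF v] in auto)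
  have D2: "(\<lambda>k. real (Suc k) * ((LINT x|lebesgue_on \<Omega>. V x * \<bar>u x + v x / real (Suc k)\<bar> powr p)
      - (LINT x|lebesgue_on \<Omega>. V x * \<bar>u x\<bar> powr p)))
      \<longlonglongrightarrow> p * (LINT x|lebesgue_on \<Omega>. V x * (\<bar>u x\<bar> powr (p - 2) * u x) * v x)"
    by (rule weighted_powr_difference_quotient[OF p Vm _ _ Vu Vv]) measurable
  have D3: "(\<lambda>k. real (Suc k) * ((LINT x|lebesgue. 1 * \<bar>u x + v x / real (Suc k)\<bar> powr p)
      - (LINT x|lebesgue. 1 * \<bar>u x\<bar> powr p)))
      \<longlonglongrightarrow> p * (LINT x|lebesgue. 1 * (\<bar>u x\<bar> powr (p - 2) * u x) * v x)"
    by (rule weighted_powr_difference_quotient[OF p])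
      (use integrable_Wsp_powr[OF u] integrable_Wsp_powr[OF v] in auto)
  have "(\<lambda>k. 1 / 2 * (real (Suc k) * ((LINT z|(lebesgue \<Otimes>\<^sub>M lebesgue). gagliardo_quot s p (\<lambda>x. u x + v x / real (Suc k)) z)
      - (LINT z|(lebesgue \<Otimes>\<^sub>M lebesgue). gagliardo_quot s p u z)))
    + real (Suc k) * ((LINT x|lebesgue_on \<Omega>. V x * \<bar>u x + v x / real (Suc k)\<bar> powr p)
      - (LINT x|lebesgue_on \<Omega>. V x * \<bar>u x\<bar> powr p))
    - l * (real (Suc k) * ((LINT x|lebesgue. 1 * \<bar>u x + v x / real (Suc k)\<bar> powr p)
      - (LINT x|lebesgue. 1 * \<bar>u x\<bar> powr p))))
    \<longlonglongrightarrow> 1 / 2 * (p * (2 * H_form s p u v)) + p * (LINT x|lebesgue_on \<Omega>. V x * (\<bar>u x\<bar> powr (p - 2) * u x) * v x)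
      - l * (p * (LINT x|lebesgue. 1 * (\<bar>u x\<bar> powr (p - 2) * u x) * v x))"
    by (intro tendsto_diff tendsto_add tendsto_mult_left D1 D2 D3)
  then show ?thesis
    using p by (simp add: F_def energy_eq algebra_simps del: of_nat_Suc)
qed

lemma ex_positive_mass_W0sp:
  fixes \<Omega> :: "(real ^ 'n) set"
  assumes s: "0 < s" "s < 1" and p: "0 < p" and \<Omega>: "open \<Omega>" "\<Omega> \<noteq> {}"
  shows "\<exists>w\<in>W0sp s p \<Omega>. 0 < (LINT x|lebesgue. \<bar>w x\<bar> powr p)"
proof -
  have \<Omega>s: "\<Omega> \<in> sets lebesgue" using \<Omega> by simp
  obtain c e where c: "c \<in> \<Omega>" and e: "0 < e" "ball c e \<subseteq> \<Omega>" using \<Omega> openE by blast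
  define r where "r = min 1 e"
  have r: "0 < r" "r \<le> 1" "ball c r \<subseteq> \<Omega>" using e by (auto simp: r_def)
  define w where "w x = max 0 (r - norm (x - c))" for x
  have w: "w \<in> Wsp s p UNIV" unfolding w_def by (rule cone_in_Wsp[OF s p r(2)])
  have "w x = 0" if "x \<notin> \<Omega>" for x
    using that r(3) by (force simp: w_def dist_norm norm_minus_commute)
  then have "w \<in> W0sp s p \<Omega>" using w by (simp add: W0sp_iff[OF \<Omega>s])
  moreover have "0 < (LINT x|lebesgue. \<bar>w x\<bar> powr p)"
  proof (rule ccontr)
    assume "\<not> ?thesis"
    moreover have "0 \<le> (LINT x|lebesgue. \<bar>w x\<bar> powr p)" by simp
    ultimately have "(LINT x|lebesgue. \<bar>w x\<bar> powr p) = 0" by linarith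
    then have "AE x in lebesgue. \<bar>w x\<bar> powr p = 0"
      by (subst (asm) integral_nonneg_eq_0_iff_AE[OF integrable_Wsp_powr[OF w]]) auto
    then have "AE x in lebesgue. x \<notin> ball c r"
      by eventually_elim (auto simp: w_def dist_norm norm_minus_commute)
    then have "emeasure lebesgue (ball c r) = 0"
      by (subst (asm) AE_iff_measurable[of "ball c r"]) auto
    then show False using emeasure_lebesgue_ball[of r c] unit_ball_vol_pos[of "real CARD('n)"] r
      by simp
  qed
  ultimately show ?thesis by blast
qed

section \<open>Existence of a minimiser\<close>

lemma energy_coercive:
  fixes s p q :: real and \<Omega> :: "(real ^ 'n) set" and V :: "real ^ 'n \<Rightarrow> real"
  assumes s: "0 < s" and p: "0 < p" and q: "1 < q" "real CARD('n) / (s * p) < q"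
    and \<Omega>: "\<Omega> \<in> sets lebesgue" and V: "V \<in> Lp q \<Omega>"
  shows "\<exists>c0. \<forall>u\<in>Wsp s p UNIV. (LINT x|lebesgue. \<bar>u x\<bar> powr p) = 1 \<longrightarrow>
    (LINT z|(lebesgue \<Otimes>\<^sub>M lebesgue). gagliardo_quot s p u z) \<le> 4 * energy s p \<Omega> V u + c0"
proof -
  obtain C \<theta> where C: "0 < C" and \<theta>: "0 < \<theta>" "\<theta> < 1" and
    bd: "\<And>(u :: real ^ 'n \<Rightarrow> real) g. u \<in> borel_measurable lebesgue \<Longrightarrow> 1 \<le> g \<Longrightarrow>
    (\<integral>\<^sup>+x. ennreal (\<bar>u x\<bar> powr p) \<partial>lebesgue) \<le> 1 \<Longrightarrow> gag_energy s p u \<le> ennreal g \<Longrightarrow>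
    (\<integral>\<^sup>+x. ennreal (\<bar>V x\<bar> * \<bar>u x\<bar> powr p) \<partial>lebesgue_on \<Omega>) \<le> ennreal (C * g powr \<theta>)"
    using potential_energy_bound(1)[OF s p q \<Omega> V] by blast
  \<comment> \<open>Beyond \<open>g0\<close> the sublinear term is at most a quarter of the linear one.\<close>
  define g0 where "g0 = (4 * C) powr (1 / (1 - \<theta>))"
  have sub: "C * g powr \<theta> \<le> g / 4 + C * g0 powr \<theta>" if g: "1 \<le> g" for g
  proof (cases "g \<le> g0")
    case True
    then have "C * g powr \<theta> \<le> C * g0 powr \<theta>" using g C \<theta> by (intro mult_left_mono powr_mono2) auto
    then show ?thesis using g by simp
  next
    case False
    have "4 * C = g0 powr (1 - \<theta>)" using C \<theta> by (simp add: g0_def powr_powr)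
    also have "\<dots> \<le> g powr (1 - \<theta>)" using False \<theta> by (intro powr_mono2) (auto simp: g0_def)
    finally have "4 * C * g powr \<theta> \<le> g powr (1 - \<theta>) * g powr \<theta>" by (intro mult_right_mono) auto
    also have "\<dots> = g" using g by (simp flip: powr_add)
    finally have "C * g powr \<theta> \<le> g / 4" by simp
    then show ?thesis using C by (simp add: add_increasing2)
  qed
  show ?thesis
  proof (intro exI ballI impI)
    fix u :: "real ^ 'n \<Rightarrow> real" assume u: "u \<in> Wsp s p UNIV" and u1: "(LINT x|lebesgue. \<bar>u x\<bar> powr p) = 1"
    have um: "u \<in> borel_measurable lebesgue" using u by (simp add: Wsp_UNIV_iff)
    define X where "X = (LINT z|(lebesgue \<Otimes>\<^sub>M lebesgue). gagliardo_quot s p u z)"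
    have X: "0 \<le> X" by (simp add: X_def)
    have EX: "gag_energy s p u = ennreal X"
      using gagliardo_powr_eq_energy[OF p u] by (simp add: gagliardo_powr_eq[OF p] X_def)
    have nn: "(\<integral>\<^sup>+x. ennreal (\<bar>u x\<bar> powr p) \<partial>lebesgue) \<le> 1"
      using u1 by (simp add: nn_integral_eq_integral[OF integrable_Wsp_powr[OF u]])
    have iV: "integrable (lebesgue_on \<Omega>) (\<lambda>x. V x * \<bar>u x\<bar> powr p)"
      by (rule integrable_potential[OF s p q \<Omega> V u])
    have iV': "integrable (lebesgue_on \<Omega>) (\<lambda>x. \<bar>V x\<bar> * \<bar>u x\<bar> powr p)"
      using integrable_abs[OF iV] by (simp add: abs_mult)
    have "ennreal (LINT x|lebesgue_on \<Omega>. \<bar>V x\<bar> * \<bar>u x\<bar> powr p) \<le> ennreal (C * (1 + X) powr \<theta>)"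
      using bd[OF um _ nn, of "1 + X"] X iV' EX by (simp add: nn_integral_eq_integral ennreal_leI)
    then have "(LINT x|lebesgue_on \<Omega>. \<bar>V x\<bar> * \<bar>u x\<bar> powr p) \<le> C * (1 + X) powr \<theta>"
      using C by (subst (asm) ennreal_le_iff) auto
    moreover define I where "I = (LINT x|lebesgue_on \<Omega>. V x * \<bar>u x\<bar> powr p)"
    have "\<bar>I\<bar> \<le> (LINT x|lebesgue_on \<Omega>. \<bar>V x\<bar> * \<bar>u x\<bar> powr p)"
      using integral_abs_bound[of "lebesgue_on \<Omega>" "\<lambda>x. V x * \<bar>u x\<bar> powr p"] by (simp add: I_def abs_mult)
    ultimately have "\<bar>I\<bar> \<le> C * (1 + X) powr \<theta>" by (rule order_trans[rotated])
    moreover have "C * (1 + X) powr \<theta> \<le> (1 + X) / 4 + C * g0 powr \<theta>" using X by (intro sub) simp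
    moreover have "energy s p \<Omega> V u = 1 / 2 * X + I"
      by (simp add: energy_eq[OF p] X_def I_def)
    moreover have "X \<le> 4 * e + (1 + 4 * k)" if "\<bar>I\<bar> \<le> a" "a \<le> (1 + X) / 4 + k" "e = 1 / 2 * X + I"
      for a k e
      using that by (simp add: field_simps)
    ultimately show "X \<le> 4 * energy s p \<Omega> V u + (1 + 4 * (C * g0 powr \<theta>))" by blast
  qed
qed

lemma integral_lebesgue_on_eq:
  fixes f :: "'a::euclidean_space \<Rightarrow> real"
  assumes "\<Omega> \<in> sets lebesgue" "\<And>x. x \<notin> \<Omega> \<Longrightarrow> f x = 0"
  shows "(LINT x|lebesgue_on \<Omega>. f x) = (LINT x|lebesgue. f x)"
    and "integrable (lebesgue_on \<Omega>) f \<longleftrightarrow> integrable lebesgue f"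
proof -
  have "(\<lambda>x. indicator \<Omega> x *\<^sub>R f x) = f" using assms(2) by (auto simp: fun_eq_iff indicator_def)
  then show "(LINT x|lebesgue_on \<Omega>. f x) = (LINT x|lebesgue. f x)"
    "integrable (lebesgue_on \<Omega>) f \<longleftrightarrow> integrable lebesgue f"
    using assms(1) by (simp_all add: integral_restrict_space integrable_restrict_space)
qed

lemma energy_minimiser_exists:
  fixes s p q :: real and \<Omega> :: "(real ^ 'n) set" and V :: "real ^ 'n \<Rightarrow> real"
  assumes s: "0 < s" "s < 1" and p: "1 < p" and \<Omega>: "open \<Omega>" "\<Omega> \<noteq> {}" "bounded \<Omega>"
    and q: "1 < q" "real CARD('n) / (s * p) < q" and V: "V \<in> Lp q \<Omega>"
  shows "\<exists>u\<in>W0sp s p \<Omega>. (LINT x|lebesgue. \<bar>u x\<bar> powr p) = 1 \<and>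
    (\<forall>w\<in>W0sp s p \<Omega>. (LINT x|lebesgue. \<bar>w x\<bar> powr p) = 1 \<longrightarrow> energy s p \<Omega> V u \<le> energy s p \<Omega> V w)"
proof -
  have p0: "0 < p" using p by simp
  have \<Omega>s: "\<Omega> \<in> sets lebesgue" using \<Omega> by simp
  have lm: "\<Omega> \<in> lmeasurable" using \<Omega> \<Omega>s by (simp add: bounded_set_imp_lmeasurable)
  note W0 = W0sp_iff[OF \<Omega>s, where s = s and p = p]
  have fm: "finite_measure (lebesgue_on \<Omega>)" using lm by (simp add: finite_measure_lebesgue_on)
  have V1: "(\<lambda>_. 1) \<in> Lp q \<Omega>" by (simp add: Lp_def finite_measure.integrable_const[OF fm])
  define X where "X u = (LINT z|(lebesgue \<Otimes>\<^sub>M lebesgue). gagliardo_quot s p u z)" for u :: "real ^ 'n \<Rightarrow> real"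
  define P where "P u = (LINT x|lebesgue_on \<Omega>. V x * \<bar>u x\<bar> powr p)" for u :: "real ^ 'n \<Rightarrow> real"
  have en: "energy s p \<Omega> V u = 1 / 2 * X u + P u" for u by (simp add: energy_eq[OF p0] X_def P_def)
  have X0: "0 \<le> X u" for u by (simp add: X_def)
  have EX: "gag_energy s p u = ennreal (X u)" if "u \<in> Wsp s p UNIV" for u
    using gagliardo_powr_eq_energy[OF p0 that] by (simp add: gagliardo_powr_eq[OF p0] X_def)
  define S where "S = {energy s p \<Omega> V w | w. w \<in> W0sp s p \<Omega> \<and> (LINT x|lebesgue. \<bar>w x\<bar> powr p) = 1}"
  obtain c0 where c0: "\<And>u. u \<in> Wsp s p UNIV \<Longrightarrow> (LINT x|lebesgue. \<bar>u x\<bar> powr p) = 1 \<Longrightarrow>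
    X u \<le> 4 * energy s p \<Omega> V u + c0"
    using energy_coercive[OF s(1) p0 q \<Omega>s V] unfolding X_def by blast
  have Sne: "S \<noteq> {}"
  proof -
    obtain w where w: "w \<in> W0sp s p \<Omega>" and pos: "0 < (LINT x|lebesgue. \<bar>w x\<bar> powr p)"
      using ex_positive_mass_W0sp[OF s p0 \<Omega>(1,2)] by blast
    define m where "m = (LINT x|lebesgue. \<bar>w x\<bar> powr p)"
    define c where "c = m powr (- 1 / p)"
    have "\<bar>c\<bar> powr p = m powr (- 1)" using p by (simp add: c_def powr_powr)
    then have cp: "\<bar>c\<bar> powr p * m = 1" using pos by (simp add: m_def powr_minus_divide)
    have "(\<lambda>x. c * w x) \<in> W0sp s p \<Omega>" using w by (simp add: W0 Wsp_scale)
    moreover have "(LINT x|lebesgue. \<bar>c * w x\<bar> powr p) = 1"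
      using cp by (simp add: abs_mult powr_mult m_def)
    ultimately show ?thesis unfolding S_def by blast
  qed
  have Sb: "- c0 / 4 \<le> e" if "e \<in> S" for e
  proof -
    obtain w where w: "w \<in> Wsp s p UNIV" "(LINT x|lebesgue. \<bar>w x\<bar> powr p) = 1" "e = energy s p \<Omega> V w"
      using \<open>e \<in> S\<close> by (auto simp: S_def W0)
    show ?thesis using c0[OF w(1,2)] X0[of w] w(3) by simp
  qed
  then have bdd: "bdd_below S" by (rule bdd_belowI)
  define \<Lambda> where "\<Lambda> = Inf S"
  have "\<exists>w. w \<in> W0sp s p \<Omega> \<and> (LINT x|lebesgue. \<bar>w x\<bar> powr p) = 1 \<and> energy s p \<Omega> V w < \<Lambda> + 1 / real (Suc k)" for k
  proof -
    have "Inf S < \<Lambda> + 1 / real (Suc k)" by (simp add: \<Lambda>_def)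
    then obtain e where "e \<in> S" "e < \<Lambda> + 1 / real (Suc k)" using cInf_lessD[OF Sne] by blast
    then show ?thesis unfolding S_def by blast
  qed
  then obtain u where u: "\<And>k. u k \<in> W0sp s p \<Omega>" "\<And>k. (LINT x|lebesgue. \<bar>u k x\<bar> powr p) = 1"
    and ue: "\<And>k. energy s p \<Omega> V (u k) < \<Lambda> + 1 / real (Suc k)" by metis
  have uW: "u k \<in> Wsp s p UNIV" and u0: "x \<notin> \<Omega> \<Longrightarrow> u k x = 0" for k x using u(1)[of k] by (auto simp: W0)
  have um [measurable]: "u k \<in> borel_measurable lebesgue" for k using uW[of k] by (simp add: Wsp_UNIV_iff)
  have u1: "(\<integral>\<^sup>+x. ennreal (\<bar>u k x\<bar> powr p) \<partial>lebesgue) \<le> 1" for k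
    using u(2) by (simp add: nn_integral_eq_integral[OF integrable_Wsp_powr[OF uW]])
  define R where "R = max 1 (4 * (\<Lambda> + 1) + c0)"
  have R0: "0 \<le> R" by (simp add: R_def)
  have uE: "gag_energy s p (u k) \<le> ennreal R" for k
  proof -
    have "1 / real (Suc k) \<le> 1" by simp
    moreover have "x \<le> R" if "x \<le> 4 * e + c0" "e < \<Lambda> + d" "d \<le> 1" for x e d
      using that by (simp add: R_def)
    ultimately have "X (u k) \<le> R" using c0[OF uW u(2), of k] ue[of k] by blast
    then show ?thesis by (simp add: EX[OF uW] ennreal_leI)
  qed
  obtain r :: "nat \<Rightarrow> nat" and v where r: "strict_mono r" and vm [measurable]: "v \<in> borel_measurable lebesgue"
    and v0: "\<And>x. x \<notin> \<Omega> \<Longrightarrow> v x = 0" and lim: "AE x in lebesgue. (\<lambda>k. u (r k) x) \<longlonglongrightarrow> v x"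
    using gag_compactness[where u = u, OF s(1) p \<Omega>(3) \<Omega>s um u0 u1 uE R0] by blast
  have meas: "w \<in> borel_measurable (lebesgue_on \<Omega>)" if "w \<in> borel_measurable lebesgue" for w :: "real ^ 'n \<Rightarrow> real"
    by (rule measurable_restrict_space1[OF that])
  note [measurable] = meas[OF um] meas[OF vm]
  \<comment> \<open>This is needed for \<open>U = V\<close> and, to keep the constraint, for \<open>U = 1\<close>.\<close>
  have limit: "integrable (lebesgue_on \<Omega>) (\<lambda>x. U x * \<bar>v x\<bar> powr p)"
    "(\<lambda>k. LINT x|lebesgue_on \<Omega>. U x * \<bar>u (r k) x\<bar> powr p) \<longlonglongrightarrow> (LINT x|lebesgue_on \<Omega>. U x * \<bar>v x\<bar> powr p)"
    if U: "U \<in> Lp q \<Omega>" for U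
  proof -
    have [measurable]: "U \<in> borel_measurable (lebesgue_on \<Omega>)" using U by (simp add: Lp_def)
    obtain a where a: "1 < a" and "\<forall>g\<ge>1. \<exists>K. \<forall>u :: real ^ 'n \<Rightarrow> real. u \<in> borel_measurable lebesgue \<longrightarrow>
      (\<integral>\<^sup>+x. ennreal (\<bar>u x\<bar> powr p) \<partial>lebesgue) \<le> 1 \<longrightarrow> gag_energy s p u \<le> ennreal g \<longrightarrow>
      (\<integral>\<^sup>+x. ennreal (\<bar>U x * \<bar>u x\<bar> powr p\<bar> powr a) \<partial>lebesgue_on \<Omega>) \<le> ennreal K"
      using potential_energy_bound(2)[OF s(1) p0 q \<Omega>s U] by blast
    moreover have "1 \<le> R" by (simp add: R_def)
    ultimately obtain K where K: "\<And>k. (\<integral>\<^sup>+x. ennreal (\<bar>U x * \<bar>u (r k) x\<bar> powr p\<bar> powr a) \<partial>lebesgue_on \<Omega>) \<le> ennreal K"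
      using um u1 uE by meson
    have "AE x in lebesgue_on \<Omega>. (\<lambda>k. u (r k) x) \<longlonglongrightarrow> v x"
      using lim \<Omega>s by (subst AE_restrict_space_iff) (auto elim: eventually_mono)
    then have L: "AE x in lebesgue_on \<Omega>. (\<lambda>k. U x * \<bar>u (r k) x\<bar> powr p) \<longlonglongrightarrow> U x * \<bar>v x\<bar> powr p"
    proof eventually_elim
      fix x assume x: "(\<lambda>k. u (r k) x) \<longlonglongrightarrow> v x"
      have "(\<lambda>k. \<bar>u (r k) x\<bar> powr p) \<longlonglongrightarrow> \<bar>v x\<bar> powr p"
        using x p by (intro tendsto_powr') (auto intro!: tendsto_intros)
      then show "(\<lambda>k. U x * \<bar>u (r k) x\<bar> powr p) \<longlonglongrightarrow> U x * \<bar>v x\<bar> powr p" by (rule tendsto_mult_left)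
    qed
    show "integrable (lebesgue_on \<Omega>) (\<lambda>x. U x * \<bar>v x\<bar> powr p)"
      by (rule convergent_integrals_of_bounded_powr(1)[OF fm a _ _ L K]) measurable
    show "(\<lambda>k. LINT x|lebesgue_on \<Omega>. U x * \<bar>u (r k) x\<bar> powr p) \<longlonglongrightarrow> (LINT x|lebesgue_on \<Omega>. U x * \<bar>v x\<bar> powr p)"
      by (rule convergent_integrals_of_bounded_powr(2)[OF fm a _ _ L K]) measurable
  qed
  have iv: "integrable lebesgue (\<lambda>x. \<bar>v x\<bar> powr p)"
    using limit(1)[OF V1] integral_lebesgue_on_eq(2)[OF \<Omega>s, of "\<lambda>x. \<bar>v x\<bar> powr p"] v0 p by simp
  have v1: "(LINT x|lebesgue. \<bar>v x\<bar> powr p) = 1"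
  proof -
    have "(LINT x|lebesgue_on \<Omega>. \<bar>u k x\<bar> powr p) = 1" for k
      using integral_lebesgue_on_eq(1)[OF \<Omega>s, of "\<lambda>x. \<bar>u k x\<bar> powr p"] u0 u(2) p by simp
    then have "(\<lambda>_. 1) \<longlonglongrightarrow> (LINT x|lebesgue_on \<Omega>. \<bar>v x\<bar> powr p)" using limit(2)[OF V1] by simp
    then have "(LINT x|lebesgue_on \<Omega>. \<bar>v x\<bar> powr p) = 1" by (simp add: LIMSEQ_const_iff)
    then show ?thesis using integral_lebesgue_on_eq(1)[OF \<Omega>s, of "\<lambda>x. \<bar>v x\<bar> powr p"] v0 p by simp
  qed
  have lower: "\<Lambda> \<le> energy s p \<Omega> V (u k)" for k
    unfolding \<Lambda>_def by (rule cInf_lower[OF _ bdd]) (use u in \<open>auto simp: S_def\<close>)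
  have upper: "energy s p \<Omega> V (u k) \<le> \<Lambda> + inverse (real (Suc k))" for k
    using less_imp_le[OF ue[of k]] by (simp only: inverse_eq_divide)
  have "(\<lambda>k. energy s p \<Omega> V (u k)) \<longlonglongrightarrow> \<Lambda>"
    by (rule tendsto_sandwich[OF always_eventually always_eventually tendsto_const
          LIMSEQ_inverse_real_of_nat_add]) (use lower upper in blast)+
  then have "(\<lambda>k. energy s p \<Omega> V (u (r k))) \<longlonglongrightarrow> \<Lambda>"
    using LIMSEQ_subseq_LIMSEQ[OF _ r] by (auto simp: o_def)
  \<comment> \<open>The energies and the potential terms converge, hence so do the Gagliardo terms, and Fatou's lemma applies to their limit.\<close>
  then have "(\<lambda>k. 2 * (energy s p \<Omega> V (u (r k)) - P (u (r k)))) \<longlonglongrightarrow> 2 * (\<Lambda> - P v)"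
    using limit(2)[OF V] unfolding P_def by (intro tendsto_intros)
  then have "(\<lambda>k. X (u (r k))) \<longlonglongrightarrow> 2 * (\<Lambda> - P v)" by (simp add: en)
  then have "(\<lambda>k. gag_energy s p (u (r k))) \<longlonglongrightarrow> ennreal (2 * (\<Lambda> - P v))"
    by (simp add: EX[OF uW] tendsto_ennrealI)
  then have "liminf (\<lambda>k. gag_energy s p (u (r k))) = ennreal (2 * (\<Lambda> - P v))"
    by (intro lim_imp_Liminf) auto
  then have Ev: "gag_energy s p v \<le> ennreal (2 * (\<Lambda> - P v))"
    using gag_energy_liminf[where u = "\<lambda>k. u (r k)", OF p0 um lim, of s] by simp
  have lim0: "0 \<le> 2 * (\<Lambda> - P v)"
    by (rule LIMSEQ_le_const[OF \<open>(\<lambda>k. X (u (r k))) \<longlonglongrightarrow> _\<close>]) (use X0 in auto)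
  have vW: "v \<in> Wsp s p UNIV"
    using Ev iv by (auto simp: Wsp_UNIV_iff integrable_iff_bounded intro: le_less_trans)
  have "X v \<le> 2 * (\<Lambda> - P v)" using Ev lim0 by (simp add: EX[OF vW])
  then have "energy s p \<Omega> V v \<le> \<Lambda>" by (simp add: en)
  moreover have "\<Lambda> \<le> energy s p \<Omega> V w" if "w \<in> W0sp s p \<Omega>" "(LINT x|lebesgue. \<bar>w x\<bar> powr p) = 1" for w
    unfolding \<Lambda>_def by (rule cInf_lower[OF _ bdd]) (use that in \<open>auto simp: S_def\<close>)
  moreover have "v \<in> W0sp s p \<Omega>" using vW v0 by (simp add: W0)
  ultimately show ?thesis using v1 by (meson order_trans)
qed

section \<open>The minimiser is an eigenfunction\<close>

lemma minimiser_is_eigenfunction: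
  fixes s p q l :: real and \<Omega> :: "(real ^ 'n) set" and V u :: "real ^ 'n \<Rightarrow> real"
  assumes s: "0 < s" and p: "1 < p" and \<Omega>: "\<Omega> \<in> sets lebesgue"
    and q: "1 < q" "real CARD('n) / (s * p) < q" and V: "V \<in> Lp q \<Omega>"
    and u: "u \<in> W0sp s p \<Omega>" "(LINT x|lebesgue. \<bar>u x\<bar> powr p) = 1" "energy s p \<Omega> V u = l"
    and least: "\<And>w. w \<in> W0sp s p \<Omega> \<Longrightarrow> (LINT x|lebesgue. \<bar>w x\<bar> powr p) = 1 \<Longrightarrow> l \<le> energy s p \<Omega> V w"
  shows "eigenfunction s p \<Omega> V l u"
proof -
  have p0: "0 < p" using p by simp
  note W0 = W0sp_iff[OF \<Omega>, where s = s and p = p]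
  have Vm: "V \<in> borel_measurable (lebesgue_on \<Omega>)" using V by (simp add: Lp_def)
  \<comment> \<open>\<open>F\<close> is homogeneous of degree \<open>p\<close>, which removes the constraint: \<open>F\<close> is minimal at \<open>u\<close> among all \<open>w\<close>.\<close>
  define F where "F w = energy s p \<Omega> V w - l * (LINT x|lebesgue. \<bar>w x\<bar> powr p)" for w
  have Fu: "F u = 0" using u by (simp add: F_def)
  have F_nonneg: "0 \<le> F w" if w: "w \<in> W0sp s p \<Omega>" for w
  proof -
    define m where "m = (LINT x|lebesgue. \<bar>w x\<bar> powr p)"
    have "0 \<le> m" by (simp add: m_def)
    then consider "m = 0" | "0 < m" by fastforce
    then show ?thesis
    proof cases
      case 1
      have wW: "w \<in> Wsp s p UNIV" using w by (simp add: W0)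
      have "AE x in lebesgue. \<bar>w x\<bar> powr p = 0"
        using 1 unfolding m_def
        by (subst (asm) integral_nonneg_eq_0_iff_AE[OF integrable_Wsp_powr[OF wW]]) auto
      then have "AE x in lebesgue_on \<Omega>. V x * \<bar>w x\<bar> powr p = 0"
        using \<Omega> by (subst AE_restrict_space_iff) (auto elim: eventually_mono)
      then have "(LINT x|lebesgue_on \<Omega>. V x * \<bar>w x\<bar> powr p) = 0" by (rule integral_eq_zero_AE)
      then show ?thesis using 1 by (simp add: F_def m_def energy_eq[OF p0])
    next
      case 2
      define c where "c = m powr (- 1 / p)"
      have "\<bar>c\<bar> powr p = m powr (- 1)" using p by (simp add: c_def powr_powr)
      then have cp: "\<bar>c\<bar> powr p = 1 / m" using 2 by (simp add: powr_minus_divide)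
      have "(\<lambda>x. c * w x) \<in> W0sp s p \<Omega>" using w by (simp add: W0 Wsp_scale)
      moreover have "(LINT x|lebesgue. \<bar>c * w x\<bar> powr p) = \<bar>c\<bar> powr p * m"
        by (simp add: abs_mult powr_mult m_def)
      ultimately have "l \<le> energy s p \<Omega> V (\<lambda>x. c * w x)" using 2 cp by (intro least) auto
      then have "l \<le> 1 / m * energy s p \<Omega> V w" by (simp add: energy_scale[OF p0] cp)
      then have "l * m \<le> energy s p \<Omega> V w" using 2 by (simp add: field_simps)
      then show ?thesis by (simp add: F_def m_def)
    qed
  qed
  define D where "D v = H_form s p u v + (LINT x|lebesgue_on \<Omega>. V x * \<bar>u x\<bar> powr (p - 2) * u x * v x)
      - l * (LINT x|lebesgue. \<bar>u x\<bar> powr (p - 2) * u x * v x)" for v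
  have D_nonneg: "0 \<le> D v" if v: "v \<in> W0sp s p \<Omega>" for v
  proof -
    have uW: "u \<in> Wsp s p UNIV" and vW: "v \<in> Wsp s p UNIV" using u v by (auto simp: W0)
    have "(\<lambda>k. real (Suc k) * (F (\<lambda>x. u x + v x / real (Suc k)) - F u)) \<longlonglongrightarrow> p * D v"
      unfolding F_def D_def
      by (rule first_variation[OF p uW vW Vm integrable_potential[OF s p0 q \<Omega> V uW]
            integrable_potential[OF s p0 q \<Omega> V vW]])
    moreover have "0 \<le> real (Suc k) * (F (\<lambda>x. u x + v x / real (Suc k)) - F u)" for k
    proof -
      have "(\<lambda>x. 1 / real (Suc k) * v x) \<in> Wsp s p UNIV" by (rule Wsp_scale[OF vW])
      then have "(\<lambda>x. u x + 1 / real (Suc k) * v x) \<in> Wsp s p UNIV"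
        using p0 by (intro Wsp_add[OF _ uW]) auto
      then have "(\<lambda>x. u x + v x / real (Suc k)) \<in> W0sp s p \<Omega>"
        using u v by (simp add: W0 del: of_nat_Suc)
      then show ?thesis using F_nonneg Fu by simp
    qed
    ultimately have "0 \<le> p * D v" by (intro LIMSEQ_le_const) auto
    then show ?thesis using p by (simp add: zero_le_mult_iff)
  qed
  have D_minus: "D (\<lambda>x. - v x) = - D v" for v
  proof -
    have "(\<lambda>(x, y). \<bar>u x - u y\<bar> powr (p - 2) * (u x - u y) * (- v x - - v y)
        / norm (x - y) powr (real CARD('n) + s * p))
      = (\<lambda>z. - (case z of (x, y) \<Rightarrow> \<bar>u x - u y\<bar> powr (p - 2) * (u x - u y) * (v x - v y)
        / norm (x - y) powr (real CARD('n) + s * p)))"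
      by (auto simp: fun_eq_iff algebra_simps diff_divide_distrib)
    then have "H_form s p u (\<lambda>x. - v x) = - H_form s p u v"
      unfolding H_form_def by (simp only: integral_minus)
    then show ?thesis by (simp add: D_def)
  qed
  have "D v = 0" if v: "v \<in> W0sp s p \<Omega>" for v
  proof -
    have "(\<lambda>x. - 1 * v x) \<in> W0sp s p \<Omega>" using v Wsp_scale[of v s p "- 1"] by (simp add: W0)
    then have "0 \<le> D (\<lambda>x. - v x)" using D_nonneg by simp
    then show ?thesis using D_nonneg[OF v] D_minus[of v] by simp
  qed
  moreover have "\<not> (AE x in lebesgue. u x = 0)"
  proof
    assume "AE x in lebesgue. u x = 0"
    then have "AE x in lebesgue. \<bar>u x\<bar> powr p = 0" by eventually_elim simp
    then have "(LINT x|lebesgue. \<bar>u x\<bar> powr p) = 0" by (rule integral_eq_zero_AE)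
    then show False using u(2) by simp
  qed
  ultimately show ?thesis using u(1) by (auto simp: eigenfunction_def D_def)
qed

theorem theorem3p3:
  fixes s p q :: real
    and \<Omega> :: "(real ^ 'n) set"
    and V :: "real ^ 'n \<Rightarrow> real"
  assumes "0 < s" and "s < 1" and "1 < p"
    and "\<Omega> \<noteq> {}" and "bounded \<Omega>" and "extension_domain s p \<Omega>"
    and "1 < q" and "real CARD('n) / (s * p) < q"
    and "V \<in> Lp q \<Omega>"
  shows "\<exists>u\<in>W0sp s p \<Omega>. Lp_norm p UNIV u = 1 \<and>
           lambda_V s p \<Omega> V =
             1 / 2 * gagliardo s p UNIV u powr p + (LINT x|lebesgue_on \<Omega>. V x * \<bar>u x\<bar> powr p) \<and>
           eigenfunction s p \<Omega> V (lambda_V s p \<Omega> V) u"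
proof -
  have op: "open \<Omega>" using assms(6) by (simp add: extension_domain_def)
  have p0: "0 < p" using assms(3) by simp
  note norm_1 = Lp_norm_UNIV_eq_1_iff[OF p0]
  obtain u where u: "u \<in> W0sp s p \<Omega>" "(LINT x|lebesgue. \<bar>u x\<bar> powr p) = 1" and
    least: "\<And>w. w \<in> W0sp s p \<Omega> \<Longrightarrow> (LINT x|lebesgue. \<bar>w x\<bar> powr p) = 1 \<Longrightarrow> energy s p \<Omega> V u \<le> energy s p \<Omega> V w"
    using energy_minimiser_exists[OF assms(1-3) op assms(4,5,7,8,9)] by blast
  have l: "lambda_V s p \<Omega> V = energy s p \<Omega> V u"
    unfolding lambda_V_def norm_1 by (rule cInf_eq_minimum) (use u least in auto)
  have "\<Omega> \<in> sets lebesgue" using op by simp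
  then have "eigenfunction s p \<Omega> V (energy s p \<Omega> V u) u"
    by (rule minimiser_is_eigenfunction[OF assms(1,3) _ assms(7-9) u refl least])
  then show ?thesis
    using u by (intro bexI[of _ u]) (auto simp: norm_1 l energy_def)
qed

end
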